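(* Let $p\in\mathcal{H}_n$. Suppose that $p^{-1}(0)\cap S_0$ is the union of distinct complex lines $\mathbb{C}a_1,\dots,\mathbb{C}a_{2n}$, where $a_1,\dots,a_{2n}\in S_0\setminus\{0\}$. Then there exists a constant $c\neq0$ such that $$p(x)p(y)=c\det\begin{pmatrix}\langle a_1,a_1\rangle^n&\dots&\langle a_1,a_{2n}\rangle^n&\langle a_1,y\rangle^n\\ \vdots&\ddots&\vdots&\vdots\\ \langle a_{2n},a_1\rangle^n&\dots&\langle a_{2n},a_{2n}\rangle^n&\langle a_{2n},y\rangle^n\\ \langle x,a_1\rangle^n&\dots&\langle x,a_{2n}\rangle^n&\langle x,y\rangle^n\end{pmatrix}$$ for all $y\in S_0$, $x\in\mathbb{C}^3$. Moreover, replacing $\langle\cdot,\cdot\rangle^n$ with $\phi(\cdot,\cdot)$ in the matrix (i.e. each entry $\langle s,t\rangle^n$ by $\phi(s,t)$), one gets such a representation of $p(x)p(y)$ for all $x,y\in\mathbb{C}^3$ (with another constant $c\ne 0$ in general).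
   Context: $\mathcal{H}_n$ is the space of complex-valued harmonic homogeneous polynomials of degree $n$ on $\mathbb{R}^3$, regarded also as holomorphic polynomials on $\mathbb{C}^3$. $\langle\cdot,\cdot\rangle$ denotes the complex-bilinear extension to $\mathbb{C}^3$ of the standard inner product of $\mathbb{R}^3$, $r^2(z)=\langle z,z\rangle$, and $S_0=\{z\in\mathbb{C}^3: r^2(z)=0\}$ is the null-cone. $\phi(a,x)$ is, for $a,x\in\mathbb{S}^2$, equal to $c_nP_n(\langle a,x\rangle)$, where $P_n$ is the $n$th Legendre polynomial and $c_n>0$ is the normalizing constant making $\phi$ the reproducing kernel of $\mathcal{H}_n|_{\mathbb{S}^2}$ with respect to the rotation-invariant probability measure on $\mathbb{S}^2$; it is extended to $\mathbb{R}^3\times\mathbb{R}^3$ as the unique function that is homogeneous of degree $n$ and harmonic in each of the two variables, and then to $\mathbb{C}^3\times\mathbb{C}^3$ holomorphically (as a polynomial). *)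

theory Defs
  imports
    "HOL-Analysis.Analysis"
    "HOL-Computational_Algebra.Polynomial"
    "Jordan_Normal_Form.Determinant"
begin


definition of_real_vec :: "real ^ 3 \<Rightarrow> complex ^ 3"
  where "of_real_vec x = (\<chi> i. complex_of_real (vec_nth x i))"

text \<open>The complex-bilinear extension of the inner product; the library's inner product on
  \<^typ>\<open>complex ^ 3\<close> is real-valued and hence not the right one.\<close>

definition bilin :: "complex ^ 3 \<Rightarrow> complex ^ 3 \<Rightarrow> complex"
  where "bilin z w = (\<Sum>i\<in>UNIV. vec_nth z i * vec_nth w i)"

definition null_cone :: "(complex ^ 3) set"
  where "null_cone = {z. bilin z z = 0}"

definition complex_line :: "complex ^ 3 \<Rightarrow> (complex ^ 3) set"
  where "complex_line a = range (\<lambda>t. t *s a)"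

definition multi_indices :: "nat \<Rightarrow> (3 \<Rightarrow> nat) set"
  where "multi_indices n = {\<alpha>. (\<Sum>i\<in>UNIV. \<alpha> i) = n}"

lemma finite_multi_indices: "finite (multi_indices n)"
proof (rule finite_subset)
  show "multi_indices n \<subseteq> Pi\<^sub>E UNIV (\<lambda>_. {..n})"
    by (auto simp: multi_indices_def PiE_def Pi_def intro!: member_le_sum)
qed (auto intro: finite_PiE)

definition homogeneous_polys :: "nat \<Rightarrow> (complex ^ 3 \<Rightarrow> complex) set"
  where "homogeneous_polys n =
    {p. \<exists>c. \<forall>z. p z = (\<Sum>\<alpha>\<in>multi_indices n. c \<alpha> * (\<Prod>i\<in>UNIV. vec_nth z i ^ \<alpha> i))}"

definition partial_deriv :: "3 \<Rightarrow> (real ^ 3 \<Rightarrow> complex) \<Rightarrow> real ^ 3 \<Rightarrow> complex"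
  where "partial_deriv i u x = vector_derivative (\<lambda>t. u (x + t *\<^sub>R axis i 1)) (at 0)"

definition laplacian :: "(real ^ 3 \<Rightarrow> complex) \<Rightarrow> real ^ 3 \<Rightarrow> complex"
  where "laplacian u x = (\<Sum>i\<in>UNIV. partial_deriv i (partial_deriv i u) x)"

text \<open>An element of \<open>\<H>\<^sub>n\<close> is represented by its holomorphic extension to
  \<open>\<complex>\<^sup>3\<close>, which is determined by the restriction to \<open>\<real>\<^sup>3\<close>; harmonicity refers to
  that restriction.\<close>

definition harmonic_polys :: "nat \<Rightarrow> (complex ^ 3 \<Rightarrow> complex) set"
  where "harmonic_polys n =
    {p \<in> homogeneous_polys n. \<forall>x. laplacian (\<lambda>x. p (of_real_vec x)) x = 0}"

text \<open>Rodrigues' formula.\<close>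

definition legendre :: "nat \<Rightarrow> real poly"
  where "legendre n = Polynomial.smult (1 / (2 ^ n * fact n)) ((pderiv ^^ n) ([:-1, 0, 1:] ^ n))"

text \<open>The rotation-invariant probability measure on the unit sphere, realised as a Borel measure on
  the ambient space: the image of the uniform distribution on the unit ball under radial projection
  \<open>sgn x = x /\<^sub>R norm x\<close>.\<close>

definition sphere_measure :: "(real ^ 3) measure"
  where "sphere_measure = distr (uniform_measure lborel (ball 0 1)) borel sgn"

lemma emeasure_lborel_ball:
  "emeasure lborel (ball 0 1 :: (real ^ 3) set) \<noteq> 0" "emeasure lborel (ball 0 1 :: (real ^ 3) set) \<noteq> \<infinity>"
  using emeasure_lborel_ball_finite[of "0 :: real ^ 3" 1] content_ball_pos[of 1 "0 :: real ^ 3"]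
  by (auto simp: measure_def)

lemma emeasure_sphere_measure:
  assumes "A \<in> sets borel"
  shows "emeasure sphere_measure A =
    emeasure lborel (ball 0 1 \<inter> sgn -` A) / emeasure lborel (ball 0 1 :: (real ^ 3) set)"
proof -
  have m: "(sgn :: real ^ 3 \<Rightarrow> _) \<in> borel_measurable borel"
    unfolding sgn_div_norm by measurable
  then have "sgn -` A \<in> sets borel"
    using measurable_sets[OF m assms] by simp
  then show ?thesis
    unfolding sphere_measure_def using m assms by (subst emeasure_distr) auto
qed

lemma sphere_measure_sphere: "emeasure sphere_measure (sphere 0 1) = 1"
proof -
  have *: "ball 0 1 \<inter> sgn -` sphere 0 1 = ball 0 1 - {0 :: real ^ 3}"
    by (auto simp: norm_sgn)
  show ?thesis
    using emeasure_lborel_ball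
    by (subst emeasure_sphere_measure)
      (auto simp: * emeasure_Diff ennreal_divide_self less_top)
qed

lemma sphere_measure_UNIV: "emeasure sphere_measure UNIV = 1"
  using emeasure_lborel_ball
  by (subst emeasure_sphere_measure) (auto simp: ennreal_divide_self less_top)

lemma sphere_measure_rotation_invariant:
  assumes T: "orthogonal_transformation T"
  shows "distr sphere_measure borel T = sphere_measure"
proof (rule measure_eqI)
  have s: "sets sphere_measure = sets borel" "space sphere_measure = UNIV"
    by (auto simp: sphere_measure_def)
  then show "sets (distr sphere_measure borel T) = sets sphere_measure"
    by simp
  fix A assume "A \<in> sets (distr sphere_measure borel T)"
  then have A: "A \<in> sets borel" by simp
  have lin: "linear T" using T orthogonal_transformation_def by blast
  then have mT: "T \<in> borel_measurable borel"
    by (intro borel_measurable_continuous_onI linear_continuous_on linear_conv_bounded_linear[THEN iffD1])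
  then have TA: "T -` A \<in> sets borel" using measurable_sets[OF mT A] by simp
  have nT: "norm (T x) = norm x" for x using T orthogonal_transformation_norm by blast
  have msgn: "(sgn :: real ^ 3 \<Rightarrow> _) \<in> borel_measurable borel"
    unfolding sgn_div_norm by measurable
  define B where "B = ball 0 1 \<inter> sgn -` (T -` A)"
  have B: "B \<in> sets borel" using measurable_sets[OF msgn TA] by (auto simp: B_def)
  have bnd: "bounded B" by (auto simp: B_def intro: bounded_subset[OF bounded_ball])
  have "sgn (T x) = T (sgn x)" for x
    by (simp add: sgn_div_norm nT linear_cmul[OF lin])
  then have TB: "T x \<in> ball 0 1 \<inter> sgn -` A \<longleftrightarrow> x \<in> B" for x
    by (simp add: nT B_def)
  have "T ` B = ball 0 1 \<inter> sgn -` A"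
  proof (intro equalityI subsetI)
    fix y assume "y \<in> ball 0 1 \<inter> sgn -` A"
    moreover obtain x where "y = T x"
      using orthogonal_transformation_surj[OF T] by (rule surjE)
    ultimately show "y \<in> T ` B" using TB by blast
  qed (use TB in blast)
  moreover have "emeasure lborel (T ` B) = emeasure lborel B"
  proof -
    have L: "B \<in> lmeasurable"
      using B bnd by (intro bounded_set_imp_lmeasurable) auto
    have "T ` B \<in> sets borel"
      using \<open>T ` B = _\<close> measurable_sets[OF msgn A] by auto
    then show ?thesis
      using measure_orthogonal_image[OF T L] measurable_orthogonal_image[OF T L] L B
        emeasure_eq_measure2[of "T ` B" lebesgue] emeasure_eq_measure2[of B lebesgue]
      by simp
  qed
  ultimately show "emeasure (distr sphere_measure borel T) A = emeasure sphere_measure A"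
    using mT A TA s
    by (subst emeasure_distr) (auto simp: emeasure_sphere_measure B_def)
qed

definition is_reproducing_kernel ::
    "nat \<Rightarrow> (complex ^ 3 \<Rightarrow> complex ^ 3 \<Rightarrow> complex) \<Rightarrow> bool"
  where "is_reproducing_kernel n K \<longleftrightarrow>
    (\<forall>a\<in>sphere 0 1.
      (\<exists>q\<in>harmonic_polys n. \<forall>x\<in>sphere 0 1.
         K (of_real_vec a) (of_real_vec x) = q (of_real_vec x)) \<and>
      (\<forall>f\<in>harmonic_polys n. f (of_real_vec a) =
         (\<integral>x. f (of_real_vec x) * cnj (K (of_real_vec a) (of_real_vec x)) \<partial>sphere_measure)))"

text \<open>\<open>\<phi>\<close> is, on pairs of points of the unit sphere, the positive multiple of
  \<open>P\<^sub>n(\<langle>a, x\<rangle>)\<close> that reproduces the spherical harmonics of degree \<open>n\<close>, and it is extended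
  off the sphere as a harmonic homogeneous polynomial of degree \<open>n\<close> in either variable.
  These requirements determine the constant and \<open>\<phi>\<close> uniquely.\<close>

definition is_zonal_kernel ::
    "nat \<Rightarrow> (complex ^ 3 \<Rightarrow> complex ^ 3 \<Rightarrow> complex) \<Rightarrow> bool"
  where "is_zonal_kernel n \<phi> \<longleftrightarrow>
    (\<exists>c>0. \<forall>a\<in>sphere 0 1. \<forall>x\<in>sphere 0 1.
       \<phi> (of_real_vec a) (of_real_vec x) = of_real (c * poly (legendre n) (inner a x))) \<and>
    is_reproducing_kernel n \<phi> \<and>
    (\<forall>z. (\<lambda>w. \<phi> z w) \<in> harmonic_polys n) \<and>
    (\<forall>w. (\<lambda>z. \<phi> z w) \<in> harmonic_polys n)"

text \<open>The rows are indexed by \<open>a\<^sub>0, \<dots>, a\<^sub>m\<^sub>-\<^sub>1, x\<close> and the columns by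
  \<open>a\<^sub>0, \<dots>, a\<^sub>m\<^sub>-\<^sub>1, y\<close>.\<close>

definition bordered_matrix ::
    "nat \<Rightarrow> ('a \<Rightarrow> 'a \<Rightarrow> complex) \<Rightarrow> (nat \<Rightarrow> 'a) \<Rightarrow> 'a \<Rightarrow> 'a \<Rightarrow> complex mat"
  where "bordered_matrix m K a x y =
    mat (m + 1) (m + 1) (\<lambda>(i, j). K (if i < m then a i else x) (if j < m then a j else y))"

end

theory Submission
  imports Defs
begin

text \<open>The quadratic map \<open>(s, t) \<mapsto> (u, v, w) = (s\<^sup>2, -t\<^sup>2, s t)\<close> parametrizes the null cone, and it turns a
  form of degree \<open>n\<close> into a binary form of degree \<open>2n\<close> and the bilinear form into
  \<open>- (s t' - t s')\<^sup>2 / 2\<close>. A harmonic form is determined by its values on the null cone, so up to a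
  factor it is determined by \<open>2n\<close> distinct null lines on which it vanishes. For null \<open>y\<close> the
  determinant is a harmonic form in \<open>x\<close> that vanishes at all \<open>a\<^sub>i\<close>, hence a multiple of \<open>p\<close>; by
  symmetry it is a constant times \<open>p(x) p(y)\<close>, and the constant is nonzero because the powers
  \<open>(s t\<^sub>j - t s\<^sub>j)\<^sup>2\<^sup>n\<close> for \<open>2n + 1\<close> distinct points are linearly independent. The zonal kernel coincides on
  pairs of null vectors with a multiple of the \<open>n\<close>-th power of the bilinear form, the factor being the
  leading coefficient of the Legendre polynomial times a positive constant; harmonicity in \<open>y\<close> then
  removes the restriction to the null cone.\<close>

subsection \<open>Polynomials in isotropic coordinates\<close>

text \<open>Coordinates in which \<open>r\<^sup>2 = u v + w\<^sup>2\<close> and the Laplacian is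
  \<open>4 \<partial>\<^sub>u \<partial>\<^sub>v + \<partial>\<^sub>w\<^sup>2\<close>.\<close>

definition cu :: "complex ^ 3 \<Rightarrow> complex"
  where "cu z = vec_nth z 1 + \<i> * vec_nth z 2"

definition cv :: "complex ^ 3 \<Rightarrow> complex"
  where "cv z = vec_nth z 1 - \<i> * vec_nth z 2"

definition cw :: "complex ^ 3 \<Rightarrow> complex"
  where "cw z = vec_nth z 3"

definition of_uvw :: "complex \<Rightarrow> complex \<Rightarrow> complex \<Rightarrow> complex ^ 3"
  where "of_uvw u v w = (\<chi> i. if i = 1 then (u + v) / 2 else if i = 2 then (u - v) / (2 * \<i>) else w)"

lemma of_uvw_nth [simp]:
  "vec_nth (of_uvw u v w) 1 = (u + v) / 2"
  "vec_nth (of_uvw u v w) 2 = (u - v) / (2 * \<i>)"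
  "vec_nth (of_uvw u v w) 3 = w"
  by (simp_all add: of_uvw_def)

lemma uvw_of_uvw [simp]:
  "cu (of_uvw u v w) = u" "cv (of_uvw u v w) = v" "cw (of_uvw u v w) = w"
  by (simp_all add: cu_def cv_def cw_def field_simps)

lemma of_uvw_uvw: "of_uvw (cu z) (cv z) (cw z) = z"
  by (simp add: Finite_Cartesian_Product.vec_eq_iff forall_3) (simp add: cu_def cv_def cw_def)

lemma uvw_linear [simp]:
  "cu (z + z') = cu z + cu z'" "cv (z + z') = cv z + cv z'" "cw (z + z') = cw z + cw z'"
  "cu (c *s z) = c * cu z" "cv (c *s z) = c * cv z" "cw (c *s z) = c * cw z"
  by (simp_all add: cu_def cv_def cw_def algebra_simps)

lemma bilin_uvw: "bilin z z' = (cu z * cv z' + cv z * cu z') / 2 + cw z * cw z'"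
proof -
  have *: "\<i> * (\<i> * x) = - x" for x :: complex
    by (simp flip: mult.assoc)
  show ?thesis
    by (simp add: bilin_def sum_3 cu_def cv_def cw_def algebra_simps *)
qed

lemma bilin_commute: "bilin z w = bilin w z"
  by (simp add: bilin_def mult.commute)

lemma bilin_smult: "bilin (c *s z) w = c * bilin z w"
  by (simp add: bilin_def sum_distrib_left mult.assoc)

text \<open>Homogeneous polynomials in the isotropic coordinates, as functions. The inductive form
  makes closure properties accessible to induction; \<open>k = 0\<close> puts the zero function in
  every degree.\<close>

inductive uvw_form :: "nat \<Rightarrow> (complex ^ 3 \<Rightarrow> complex) \<Rightarrow> bool" where
  monom: "a + b + c = n \<Longrightarrow> uvw_form n (\<lambda>z. k * (cu z ^ a * cv z ^ b * cw z ^ c))"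
| add: "uvw_form n f \<Longrightarrow> uvw_form n g \<Longrightarrow> uvw_form n (\<lambda>z. f z + g z)"

lemma uvw_form_cmult:
  assumes "uvw_form n f"
  shows "uvw_form n (\<lambda>z. c * f z)"
  using assms
proof induction
  case (monom a b c' n k)
  then show ?case
    using uvw_form.monom[of a b c' n "c * k"] by (simp add: mult.assoc)
next
  case (add n f g)
  then show ?case
    using uvw_form.add by (simp add: distrib_left)
qed

lemma uvw_form_sum:
  assumes "finite I" "\<And>i. i \<in> I \<Longrightarrow> uvw_form n (f i)"
  shows "uvw_form n (\<lambda>z. \<Sum>i\<in>I. f i z)"
  using assms
proof induction
  case empty
  then show ?case
    using monom[of n 0 0 n 0] by simp
next
  case (insert i I)
  then show ?case
    using add by simp
qed

lemma uvw_form_mult: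
  assumes "uvw_form m f" "uvw_form n g"
  shows "uvw_form (m + n) (\<lambda>z. f z * g z)"
  using assms
proof (induction arbitrary: g)
  case (monom a b c m k)
  show ?case
    using monom(2)
  proof induction
    case (monom a' b' c' n k')
    then show ?case
      using uvw_form.monom[of "a + a'" "b + b'" "c + c'" "m + n" "k * k'"] \<open>a + b + c = m\<close>
      by (simp add: power_add ac_simps)
  next
    case (add n f g)
    then show ?case
      using uvw_form.add by (simp add: distrib_left)
  qed
next
  case (add m f g')
  then show ?case
    using uvw_form.add by (simp add: distrib_right)
qed

lemma uvw_form_power:
  assumes "uvw_form 1 f"
  shows "uvw_form n (\<lambda>z. f z ^ n)"
proof (induction n)
  case 0
  then show ?case
    using monom[of 0 0 0 0 1] by simp
next
  case (Suc n)
  then show ?case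
    using uvw_form_mult[OF assms Suc] by simp
qed

lemma uvw_form_nth: "uvw_form 1 (\<lambda>z. vec_nth z i)"
proof -
  have u: "uvw_form 1 (\<lambda>z. k * cu z)" and v: "uvw_form 1 (\<lambda>z. k * cv z)"
    and w: "uvw_form 1 cw" for k
    using monom[of 1 0 0 1 k] monom[of 0 1 0 1 k] monom[of 0 0 1 1 1] by auto
  have "uvw_form 1 (\<lambda>z. vec_nth z 1)" "uvw_form 1 (\<lambda>z. vec_nth z 2)"
    using add[OF u[of "1/2"] v[of "1/2"]] add[OF u[of "- \<i> / 2"] v[of "\<i> / 2"]]
    by (simp_all add: cu_def cv_def field_simps)
  moreover have "uvw_form 1 (\<lambda>z. vec_nth z 3)"
    using w by (simp add: cw_def[abs_def])
  ultimately show ?thesis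
    using exhaust_3[of i] by auto
qed

lemma uvw_form_homogeneous_polys:
  assumes "p \<in> homogeneous_polys n"
  shows "uvw_form n p"
proof -
  obtain c where c: "\<And>z. p z = (\<Sum>\<alpha>\<in>multi_indices n. c \<alpha> * (\<Prod>i\<in>UNIV. vec_nth z i ^ \<alpha> i))"
    using assms unfolding homogeneous_polys_def mem_Collect_eq by (elim exE) (rule that, erule spec)
  have "uvw_form n (\<lambda>z. \<Prod>i\<in>UNIV. vec_nth z i ^ \<alpha> i)" if "\<alpha> \<in> multi_indices n" for \<alpha>
  proof -
    have "\<alpha> 1 + \<alpha> 2 + \<alpha> 3 = n"
      using that unfolding multi_indices_def mem_Collect_eq sum_3 .
    moreover have "uvw_form (\<alpha> 1 + \<alpha> 2 + \<alpha> 3)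
        (\<lambda>z. vec_nth z 1 ^ \<alpha> 1 * vec_nth z 2 ^ \<alpha> 2 * vec_nth z 3 ^ \<alpha> 3)"
      by (intro uvw_form_mult uvw_form_power uvw_form_nth)
    moreover have "(\<Prod>i\<in>UNIV. vec_nth z i ^ \<alpha> i) =
        vec_nth z 1 ^ \<alpha> 1 * vec_nth z 2 ^ \<alpha> 2 * vec_nth z 3 ^ \<alpha> 3" for z :: "complex ^ 3"
      unfolding UNIV_3 by (simp add: ac_simps)
    ultimately show ?thesis
      by simp
  qed
  then have "uvw_form n (\<lambda>z. \<Sum>\<alpha>\<in>multi_indices n. c \<alpha> * (\<Prod>i\<in>UNIV. vec_nth z i ^ \<alpha> i))"
    by (intro uvw_form_sum uvw_form_cmult finite_multi_indices)
  moreover have "p = (\<lambda>z. \<Sum>\<alpha>\<in>multi_indices n. c \<alpha> * (\<Prod>i\<in>UNIV. vec_nth z i ^ \<alpha> i))"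
    using c by (intro ext)
  ultimately show ?thesis
    by simp
qed

lemma uvw_form_bilin_power: "uvw_form n (\<lambda>z. bilin z b ^ n)"
proof -
  have "uvw_form 1 (\<lambda>z. \<Sum>i\<in>UNIV. vec_nth b i * vec_nth z i)"
    by (intro uvw_form_sum uvw_form_cmult uvw_form_nth) auto
  then show ?thesis
    by (intro uvw_form_power) (simp add: bilin_def mult.commute)
qed

lemma uvw_form_homogeneous:
  assumes "uvw_form n f"
  shows "f (c *s z) = c ^ n * f z"
  using assms
proof induction
  case (monom a b c' n k)
  then have "c ^ n = c ^ a * c ^ b * c ^ c'"
    by (metis power_add)
  then show ?case
    by (simp add: power_mult_distrib)
next
  case (add n f g)
  then show ?case
    by (simp add: distrib_left)
qed

definition exponents :: "nat \<Rightarrow> (nat \<times> nat \<times> nat) set"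
  where "exponents n = {(a, b, c). a + b + c = n}"

lemma finite_exponents: "finite (exponents n)"
  by (rule finite_subset[of _ "{..n} \<times> {..n} \<times> {..n}"]) (auto simp: exponents_def)

fun uvw_monom :: "nat \<times> nat \<times> nat \<Rightarrow> complex ^ 3 \<Rightarrow> complex"
  where "uvw_monom (a, b, c) z = cu z ^ a * cv z ^ b * cw z ^ c"

lemma uvw_form_coeffs:
  assumes "uvw_form n f"
  obtains C where "\<And>z. f z = (\<Sum>e\<in>exponents n. C e * uvw_monom e z)"
proof -
  have "\<exists>C. \<forall>z. f z = (\<Sum>e\<in>exponents n. C e * uvw_monom e z)"
    using assms
  proof induction
    case (monom a b c n k)
    have "(a, b, c) \<in> exponents n"
      using monom by (simp add: exponents_def)
    then have "k * (cu z ^ a * cv z ^ b * cw z ^ c) =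
        (\<Sum>e\<in>exponents n. if e = (a, b, c) then k * uvw_monom e z else 0)" for z
      by (simp add: sum.delta[OF finite_exponents])
    also have "(\<Sum>e\<in>exponents n. if e = (a, b, c) then k * uvw_monom e z else 0) =
        (\<Sum>e\<in>exponents n. (if e = (a, b, c) then k else 0) * uvw_monom e z)" for z
      by (intro sum.cong) simp_all
    finally show ?case
      by (intro exI allI)
  next
    case (add n f g)
    then obtain C D where
      "\<forall>z. f z = (\<Sum>e\<in>exponents n. C e * uvw_monom e z)"
      "\<forall>z. g z = (\<Sum>e\<in>exponents n. D e * uvw_monom e z)"
      by blast
    then have "\<forall>z. f z + g z = (\<Sum>e\<in>exponents n. (C e + D e) * uvw_monom e z)"
      by (simp add: distrib_right sum.distrib)
    then show ?case
      by (intro exI)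
  qed
  then show ?thesis
    using that by blast
qed

subsection \<open>Restriction to complex lines\<close>

text \<open>A substitute for polynomials in three variables that suffices for carrying identities
  from real to complex points.\<close>

definition poly_on_lines :: "(complex ^ 3 \<Rightarrow> complex) \<Rightarrow> bool"
  where "poly_on_lines f \<longleftrightarrow> (\<forall>z z'. \<exists>q. \<forall>t. f (z + t *s z') = poly q t)"

lemma poly_on_lines_const: "poly_on_lines (\<lambda>z. c)"
  unfolding poly_on_lines_def by (intro allI exI[of _ "[:c:]"]) simp

lemma poly_on_lines_add: "poly_on_lines f \<Longrightarrow> poly_on_lines g \<Longrightarrow> poly_on_lines (\<lambda>z. f z + g z)"
  unfolding poly_on_lines_def by (metis poly_add)

lemma poly_on_lines_mult: "poly_on_lines f \<Longrightarrow> poly_on_lines g \<Longrightarrow> poly_on_lines (\<lambda>z. f z * g z)"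
  unfolding poly_on_lines_def by (metis poly_mult)

lemma poly_on_lines_power: "poly_on_lines f \<Longrightarrow> poly_on_lines (\<lambda>z. f z ^ k)"
  by (induction k) (simp_all add: poly_on_lines_const poly_on_lines_mult)

lemma poly_on_lines_sum: "(\<And>i. i \<in> I \<Longrightarrow> poly_on_lines (f i)) \<Longrightarrow> poly_on_lines (\<lambda>z. \<Sum>i\<in>I. f i z)"
  by (induction I rule: infinite_finite_induct) (simp_all add: poly_on_lines_const poly_on_lines_add)

lemma poly_on_lines_uvw: "poly_on_lines cu" "poly_on_lines cv" "poly_on_lines cw"
proof -
  have "poly_on_lines f" if f: "\<And>z z' t. f (z + t *s z') = f z + t * f z'" for f
    unfolding poly_on_lines_def
  proof (intro allI)
    fix z z'
    show "\<exists>q. \<forall>t. f (z + t *s z') = poly q t"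
      by (rule exI[of _ "[:f z, f z':]"]) (simp add: f)
  qed
  then show "poly_on_lines cu" "poly_on_lines cv" "poly_on_lines cw"
    by simp_all
qed

lemmas poly_on_lines_intros =
  poly_on_lines_const poly_on_lines_add poly_on_lines_mult poly_on_lines_power poly_on_lines_sum
  poly_on_lines_uvw

lemma poly_on_lines_uvw_form: "uvw_form n f \<Longrightarrow> poly_on_lines f"
  by (induction rule: uvw_form.induct) (auto intro!: poly_on_lines_intros)

section \<open>Passage from real to complex points\<close>

lemma complex_vec_decomp:
  obtains x y where "z = of_real_vec x + \<i> *s of_real_vec y"
proof
  show "z = of_real_vec (\<chi> i. Re (vec_nth z i)) + \<i> *s of_real_vec (\<chi> i. Im (vec_nth z i))"
    by (simp add: Finite_Cartesian_Product.vec_eq_iff of_real_vec_def complex_eq_iff)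
qed

lemma of_real_vec_line:
  "of_real_vec x + complex_of_real t *s of_real_vec y = of_real_vec (x + t *\<^sub>R y)"
  by (simp add: Finite_Cartesian_Product.vec_eq_iff of_real_vec_def)

lemma poly_eq_on_reals:
  fixes q q' :: "complex poly"
  assumes "\<And>t :: real. poly q (of_real t) = poly q' (of_real t)"
  shows "q = q'"
proof (rule ccontr)
  assume "q \<noteq> q'"
  then have "finite {t. poly (q - q') t = 0}"
    by (intro poly_roots_finite) simp
  moreover have "range complex_of_real \<subseteq> {t. poly (q - q') t = 0}"
    using assms by auto
  ultimately have "finite (range complex_of_real)"
    by (rule rev_finite_subset)
  then have "finite (UNIV :: real set)"
    by (rule finite_imageD) (simp add: inj_def)
  then show False
    by (simp add: infinite_UNIV_char_0)
qed

text \<open>On the complex line t -> x + t y both functions are polynomials in t that agree for real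
  t, hence also at t = i.\<close>

lemma poly_on_lines_eqI:
  assumes "poly_on_lines f" "poly_on_lines g"
    and "\<And>t :: real. f (of_real_vec (x + t *\<^sub>R y)) = g (of_real_vec (x + t *\<^sub>R y))"
  shows "f (of_real_vec x + \<i> *s of_real_vec y) = g (of_real_vec x + \<i> *s of_real_vec y)"
proof -
  obtain q q' where
    q: "\<And>t. f (of_real_vec x + t *s of_real_vec y) = poly q t"
    and q': "\<And>t. g (of_real_vec x + t *s of_real_vec y) = poly q' t"
    using assms(1,2) unfolding poly_on_lines_def by meson
  have "q = q'"
    using assms(3) by (intro poly_eq_on_reals) (metis q q' of_real_vec_line)
  then show ?thesis
    using q q' by simp
qed

lemma poly_on_lines_vanish:
  assumes "poly_on_lines f" "\<And>x. f (of_real_vec x) = 0"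
  shows "f z = 0"
proof -
  obtain x y where "z = of_real_vec x + \<i> *s of_real_vec y"
    by (rule complex_vec_decomp)
  then show ?thesis
    using poly_on_lines_eqI[OF assms(1) poly_on_lines_const[of 0]] assms(2) by simp
qed

subsection \<open>Harmonic forms\<close>

definition has_partial :: "3 \<Rightarrow> (complex ^ 3 \<Rightarrow> complex) \<Rightarrow> (complex ^ 3 \<Rightarrow> complex) \<Rightarrow> bool"
  where "has_partial i f g \<longleftrightarrow>
    (\<forall>z. ((\<lambda>t. f (z + t *s axis i 1)) has_field_derivative g z) (at 0))"

lemma partial_deriv_of_real_vec:
  assumes "has_partial i f g"
  shows "partial_deriv i (\<lambda>x. f (of_real_vec x)) = (\<lambda>x. g (of_real_vec x))"
proof
  fix x
  have "of_real_vec (x + t *\<^sub>R axis i 1) = of_real_vec x + of_real t *s axis i 1" for t :: real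
    by (simp add: Finite_Cartesian_Product.vec_eq_iff of_real_vec_def axis_def)
  moreover have "((\<lambda>t :: real. f (of_real_vec x + of_real t *s axis i 1))
      has_vector_derivative g (of_real_vec x)) (at 0)"
    using assms by (intro has_vector_derivative_real_field) (simp add: has_partial_def)
  ultimately show "partial_deriv i (\<lambda>x. f (of_real_vec x)) x = g (of_real_vec x)"
    unfolding partial_deriv_def by (simp add: vector_derivative_at)
qed

lemma laplacian_of_real_vec:
  assumes "\<And>i. has_partial i f (g i)" "\<And>i. has_partial i (g i) (h i)"
  shows "laplacian (\<lambda>x. f (of_real_vec x)) x = (\<Sum>i\<in>UNIV. h i (of_real_vec x))"
  unfolding laplacian_def
  using partial_deriv_of_real_vec[OF assms(1)] partial_deriv_of_real_vec[OF assms(2)] by simp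

lemma has_partial_add:
  "has_partial i f g \<Longrightarrow> has_partial i f' g' \<Longrightarrow> has_partial i (\<lambda>z. f z + f' z) (\<lambda>z. g z + g' z)"
  by (auto simp: has_partial_def intro!: derivative_intros)

lemma has_partial_cmult:
  "has_partial i f g \<Longrightarrow> has_partial i (\<lambda>z. c * f z) (\<lambda>z. c * g z)"
  by (auto simp: has_partial_def intro!: DERIV_cmult)

lemma has_partial_sum:
  "(\<And>e. e \<in> E \<Longrightarrow> has_partial i (f e) (g e)) \<Longrightarrow>
    has_partial i (\<lambda>z. \<Sum>e\<in>E. f e z) (\<lambda>z. \<Sum>e\<in>E. g e z)"
  by (auto simp: has_partial_def intro!: DERIV_sum)

text \<open>Since \<open>cu\<close>, \<open>cv\<close>, \<open>cw\<close> are linear, their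
  derivatives along an axis are their values at the axis vector. Where \<open>a - 1\<close>
  truncates, the factor \<open>of_nat a\<close> is zero.\<close>

lemma has_partial_uvw_monom:
  "has_partial i (uvw_monom (a, b, c)) (\<lambda>z.
      of_nat a * cu (axis i 1) * uvw_monom (a - 1, b, c) z
    + of_nat b * cv (axis i 1) * uvw_monom (a, b - 1, c) z
    + of_nat c * cw (axis i 1) * uvw_monom (a, b, c - 1) z)"
  unfolding has_partial_def uvw_monom.simps uvw_linear
  by (intro allI) (rule derivative_eq_intros refl | simp add: algebra_simps)+

text \<open>The operator 4 d_u d_v + d_w^2 applied to a monomial. Truncated exponents occur only
  with coefficient zero.\<close>

fun uvw_laplacian :: "nat \<times> nat \<times> nat \<Rightarrow> complex ^ 3 \<Rightarrow> complex"
  where "uvw_laplacian (a, b, c) z =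
    4 * of_nat a * of_nat b * uvw_monom (a - 1, b - 1, c) z
    + of_nat c * of_nat (c - 1) * uvw_monom (a, b, c - 2) z"

lemma uvw_axis:
  "cu (axis 1 1) = 1" "cv (axis 1 1) = 1" "cw (axis 1 1) = 0"
  "cu (axis 2 1) = \<i>" "cv (axis 2 1) = - \<i>" "cw (axis 2 1) = 0"
  "cu (axis 3 1) = 0" "cv (axis 3 1) = 0" "cw (axis 3 1) = 1"
  by (simp_all add: cu_def cv_def cw_def axis_def)

lemma uvw_laplacian:
  obtains g h where "\<And>i. has_partial i (uvw_monom e) (g i)" "\<And>i. has_partial i (g i) (h i)"
    "\<And>z. (\<Sum>i\<in>UNIV. h i z) = uvw_laplacian e z"
proof (cases e)
  case [simp]: (fields a b c)
  define d where "d i e = (case e of (a, b, c) \<Rightarrow> \<lambda>z.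
      of_nat a * cu (axis i 1) * uvw_monom (a - 1, b, c) z
    + of_nat b * cv (axis i 1) * uvw_monom (a, b - 1, c) z
    + of_nat c * cw (axis i 1) * uvw_monom (a, b, c - 1) z)" for i e
  have d: "has_partial i (uvw_monom e) (d i e)" for i e
    by (cases e) (simp only: d_def prod.case has_partial_uvw_monom)
  define h where "h i = (\<lambda>z. of_nat a * cu (axis i 1) * d i (a - 1, b, c) z
    + of_nat b * cv (axis i 1) * d i (a, b - 1, c) z
    + of_nat c * cw (axis i 1) * d i (a, b, c - 1) z)" for i
  show ?thesis
  proof (rule that[of "\<lambda>i. d i e" h])
    show "has_partial i (uvw_monom e) (d i e)" for i
      by (rule d)
    show "has_partial i (d i e) (h i)" for i
      unfolding d_def fields prod.case h_def
      by (intro has_partial_add has_partial_cmult has_partial_uvw_monom)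
    have *: "\<i> * (\<i> * x) = - x" for x
      by (simp flip: mult.assoc)
    \<comment> \<open>The second derivatives in u alone and in v alone cancel between axes 1 and 2
      because i^2 = -1; the mixed ones add up with factor 4.\<close>
    show "(\<Sum>i\<in>UNIV. h i z) = uvw_laplacian e z" for z
      unfolding sum_3 h_def d_def prod.case uvw_axis fields uvw_laplacian.simps
      by (simp add: * algebra_simps numeral_2_eq_2 del: uvw_monom.simps)
  qed
qed

lemma laplacian_uvw_sum:
  assumes "\<And>z. f z = (\<Sum>e\<in>E. C e * uvw_monom e z)"
  shows "laplacian (\<lambda>x. f (of_real_vec x)) x = (\<Sum>e\<in>E. C e * uvw_laplacian e (of_real_vec x))"
proof -
  have "\<forall>e. \<exists>g h. (\<forall>i. has_partial i (uvw_monom e) (g i)) \<and> (\<forall>i. has_partial i (g i) (h i)) \<and>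
      (\<forall>z. (\<Sum>i\<in>UNIV. h i z) = uvw_laplacian e z)"
    using uvw_laplacian by metis
  then obtain g h where
    g: "\<And>e i. has_partial i (uvw_monom e) (g e i)" and
    h: "\<And>e i. has_partial i (g e i) (h e i)" and
    l: "\<And>e z. (\<Sum>i\<in>UNIV. h e i z) = uvw_laplacian e z"
    by metis
  have f: "f = (\<lambda>z. \<Sum>e\<in>E. C e * uvw_monom e z)"
    using assms by (intro ext)
  have "laplacian (\<lambda>x. f (of_real_vec x)) x = (\<Sum>i\<in>UNIV. \<Sum>e\<in>E. C e * h e i (of_real_vec x))"
  proof (rule laplacian_of_real_vec)
    show "has_partial i f (\<lambda>z. \<Sum>e\<in>E. C e * g e i z)" for i
      unfolding f by (intro has_partial_sum has_partial_cmult g)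
    show "has_partial i (\<lambda>z. \<Sum>e\<in>E. C e * g e i z) (\<lambda>z. \<Sum>e\<in>E. C e * h e i z)" for i
      by (intro has_partial_sum has_partial_cmult h)
  qed
  also have "\<dots> = (\<Sum>e\<in>E. C e * uvw_laplacian e (of_real_vec x))"
    by (subst sum.swap) (simp only: l sum_distrib_left[symmetric])
  finally show ?thesis .
qed

definition harmonic_form :: "nat \<Rightarrow> (complex ^ 3 \<Rightarrow> complex) \<Rightarrow> bool"
  where "harmonic_form n f \<longleftrightarrow>
    uvw_form n f \<and> (\<forall>x. laplacian (\<lambda>x. f (of_real_vec x)) x = 0)"

lemma harmonic_form_harmonic_polys: "p \<in> harmonic_polys n \<Longrightarrow> harmonic_form n p"
  by (simp add: harmonic_form_def harmonic_polys_def uvw_form_homogeneous_polys)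

text \<open>Additivity of \<open>laplacian\<close> is read off from the expansions of
  \<open>f\<close> and \<open>g\<close> into monomials, whose Laplacians are explicit.\<close>

lemma harmonic_form_add:
  assumes "harmonic_form n f" "harmonic_form n g"
  shows "harmonic_form n (\<lambda>z. f z + g z)"
proof -
  have f: "uvw_form n f" and g: "uvw_form n g"
    using assms by (simp_all add: harmonic_form_def)
  obtain C where C: "\<And>z. f z = (\<Sum>e\<in>exponents n. C e * uvw_monom e z)"
    using uvw_form_coeffs[OF f] by metis
  obtain D where D: "\<And>z. g z = (\<Sum>e\<in>exponents n. D e * uvw_monom e z)"
    using uvw_form_coeffs[OF g] by metis
  have "f z + g z = (\<Sum>e\<in>exponents n. (C e + D e) * uvw_monom e z)" for z
    by (simp only: C D distrib_right sum.distrib)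
  from laplacian_uvw_sum[OF this]
  have "laplacian (\<lambda>x. f (of_real_vec x) + g (of_real_vec x)) x =
      laplacian (\<lambda>x. f (of_real_vec x)) x + laplacian (\<lambda>x. g (of_real_vec x)) x" for x
    by (simp only: laplacian_uvw_sum[OF C] laplacian_uvw_sum[OF D] distrib_right sum.distrib)
  with assms show ?thesis
    by (simp add: harmonic_form_def uvw_form.add)
qed

lemma harmonic_form_cmult:
  assumes "harmonic_form n f"
  shows "harmonic_form n (\<lambda>z. c * f z)"
proof -
  have f: "uvw_form n f"
    using assms by (simp add: harmonic_form_def)
  obtain C where C: "\<And>z. f z = (\<Sum>e\<in>exponents n. C e * uvw_monom e z)"
    using uvw_form_coeffs[OF f] by metis
  have "c * f z = (\<Sum>e\<in>exponents n. (c * C e) * uvw_monom e z)" for z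
    by (simp only: C sum_distrib_left mult.assoc)
  from laplacian_uvw_sum[OF this]
  have "laplacian (\<lambda>x. c * f (of_real_vec x)) x = c * laplacian (\<lambda>x. f (of_real_vec x)) x" for x
    by (simp only: laplacian_uvw_sum[OF C] sum_distrib_left mult.assoc)
  with assms show ?thesis
    by (simp add: harmonic_form_def uvw_form_cmult)
qed

lemma harmonic_form_sum:
  assumes "finite I" "I \<noteq> {}" "\<And>i. i \<in> I \<Longrightarrow> harmonic_form n (f i)"
  shows "harmonic_form n (\<lambda>z. \<Sum>i\<in>I. f i z)"
  using assms by (induction I rule: finite_ne_induct) (simp_all add: harmonic_form_add)

lemma has_partial_bilin_power:
  "has_partial i (\<lambda>z. bilin z b ^ n) (\<lambda>z. of_nat n * vec_nth b i * bilin z b ^ (n - 1))"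
proof -
  have "bilin (z + t *s axis i 1) b = bilin z b + t * vec_nth b i" for z t
  proof -
    have "bilin (z + t *s axis i 1) b =
        bilin z b + t * (\<Sum>j\<in>UNIV. vec_nth (axis i 1) j * vec_nth b j)"
      by (simp add: bilin_def sum.distrib distrib_right sum_distrib_left mult.assoc)
    also have "(\<Sum>j\<in>UNIV. vec_nth (axis i 1) j * vec_nth b j) =
        (\<Sum>j\<in>UNIV. if j = i then vec_nth b j else 0)"
      by (intro sum.cong) (simp_all add: axis_def)
    finally show ?thesis
      by simp
  qed
  then show ?thesis
    unfolding has_partial_def by (auto intro!: derivative_eq_intros)
qed

text \<open>Differentiating twice along each axis and summing produces the factor
  \<open>bilin b b\<close>, which is zero.\<close>

lemma harmonic_form_bilin_power:
  assumes "b \<in> null_cone"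
  shows "harmonic_form n (\<lambda>z. bilin z b ^ n)"
proof -
  have "laplacian (\<lambda>x. bilin (of_real_vec x) b ^ n) x = (\<Sum>i\<in>UNIV. of_nat n * vec_nth b i *
      (of_nat (n - 1) * vec_nth b i * bilin (of_real_vec x) b ^ (n - 1 - 1)))" for x
    by (rule laplacian_of_real_vec[OF has_partial_bilin_power])
      (rule has_partial_cmult[OF has_partial_bilin_power])
  also have "\<dots> x = (\<Sum>i\<in>UNIV. of_nat n * of_nat (n - 1) * bilin (of_real_vec x) b ^ (n - 1 - 1) *
      (vec_nth b i * vec_nth b i))" for x
    by (simp only: ac_simps)
  also have "\<dots> x = of_nat n * of_nat (n - 1) * bilin (of_real_vec x) b ^ (n - 1 - 1) * bilin b b" for x
    by (simp only: bilin_def[of b b] sum_distrib_left)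
  finally show ?thesis
    using assms by (simp add: harmonic_form_def uvw_form_bilin_power null_cone_def)
qed

subsection \<open>Harmonic forms are determined by their values on the null cone\<close>

text \<open>Uniqueness of digits in base \<open>M\<close>; it makes the substitution v = u^M
  injective on monomials whose u-exponent is below \<open>M\<close>.\<close>

lemma radix_eq_iff:
  fixes x y M :: nat
  assumes "x < M" "x' < M"
  shows "x + M * y = x' + M * y' \<longleftrightarrow> x = x' \<and> y = y'"
proof
  assume eq: "x + M * y = x' + M * y'"
  then have "(x + M * y) mod M = (x' + M * y') mod M"
    by simp
  then have "x = x'"
    using assms by simp
  then show "x = x' \<and> y = y'"
    using eq assms by simp
qed simp

text \<open>Comparison of coefficients of u^a v^b w^c in the vanishing Laplacian of
  \<open>f\<close>: this monomial arises only from d_u d_v at (a+1, b+1, c) and from d_w^2 at (a, b,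
  c+2).\<close>

lemma harmonic_form_recurrence:
  assumes "harmonic_form n f" and C: "\<And>z. f z = (\<Sum>e\<in>exponents n. C e * uvw_monom e z)"
    and n: "a + b + c + 2 = n"
  shows "of_nat ((c + 2) * (c + 1)) * C (a, b, c + 2) =
    - of_nat (4 * (a + 1) * (b + 1)) * C (a + 1, b + 1, c)"
proof -
  have "(\<Sum>e\<in>exponents n. C e * uvw_laplacian e z) = 0" for z
  \<comment> \<open>Harmonicity is given at real points, whereas the points substituted below are
    complex.\<close>
  proof (rule poly_on_lines_vanish)
    have "poly_on_lines (uvw_laplacian e)" for e
    proof (cases e)
      case (fields a b c)
      then have "uvw_laplacian e = (\<lambda>z.
          4 * of_nat a * of_nat b * (cu z ^ (a - 1) * cv z ^ (b - 1) * cw z ^ c) +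
          of_nat c * of_nat (c - 1) * (cu z ^ a * cv z ^ b * cw z ^ (c - 2)))"
        by (intro ext) (simp only: uvw_laplacian.simps uvw_monom.simps)
      then show ?thesis
        by (simp only:) (intro poly_on_lines_intros)
    qed
    then show "poly_on_lines (\<lambda>z. \<Sum>e\<in>exponents n. C e * uvw_laplacian e z)"
      by (intro poly_on_lines_sum poly_on_lines_mult poly_on_lines_const)
    show "(\<Sum>e\<in>exponents n. C e * uvw_laplacian e (of_real_vec x)) = 0" for x
      using assms(1) by (simp add: harmonic_form_def laplacian_uvw_sum[OF C])
  qed
  \<comment> \<open>Kronecker substitution u = x, v = x^(n+1), w = 1: the u- and v-exponents become
    the digits of one exponent of x, and the w-exponent is fixed by the degree.\<close>
  then have 0: "(\<Sum>e\<in>exponents n. C e * uvw_laplacian e (of_uvw x (x ^ Suc n) 1)) = 0" for x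
    by simp
  define P where "P = (\<Sum>e\<in>exponents n. case e of (a, b, c) \<Rightarrow>
      Polynomial.monom (C e * (4 * of_nat a * of_nat b)) (a - 1 + Suc n * (b - 1)) +
      Polynomial.monom (C e * (of_nat c * of_nat (c - 1))) (a + Suc n * b))"
  have "poly P x = 0" for x
  proof -
    have "poly P x = (\<Sum>e\<in>exponents n. C e * uvw_laplacian e (of_uvw x (x ^ Suc n) 1))"
      unfolding P_def poly_sum
    proof (rule sum.cong[OF refl])
      fix e
      show "poly (case e of (a, b, c) \<Rightarrow>
          Polynomial.monom (C e * (4 * of_nat a * of_nat b)) (a - 1 + Suc n * (b - 1)) +
          Polynomial.monom (C e * (of_nat c * of_nat (c - 1))) (a + Suc n * b)) x =
          C e * uvw_laplacian e (of_uvw x (x ^ Suc n) 1)"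
        by (cases e)
          (simp only: prod.case poly_add poly_monom uvw_laplacian.simps uvw_monom.simps uvw_of_uvw
            power_mult power_add power_one mult_1_right distrib_left mult.assoc)
    qed
    then show ?thesis
      using 0 by simp
  qed
  then have "P = 0"
    using poly_all_0_iff_0 by blast
  then have "0 = coeff P (a + Suc n * b)"
    by simp
  also have "\<dots> = (\<Sum>e\<in>exponents n.
      (if e = (a + 1, b + 1, c) then of_nat (4 * (a + 1) * (b + 1)) * C e else 0) +
      (if e = (a, b, c + 2) then of_nat ((c + 2) * (c + 1)) * C e else 0))"
    unfolding P_def coeff_sum
  proof (rule sum.cong[OF refl])
    fix e assume e: "e \<in> exponents n"
    obtain a' b' c' where [simp]: "e = (a', b', c')"
      by (cases e)
    have n': "a' + b' + c' = n"
      using e by (simp add: exponents_def)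
    have 1: "a' - 1 + Suc n * (b' - 1) = a + Suc n * b \<longleftrightarrow> a' - 1 = a \<and> b' - 1 = b"
      using n n' by (intro radix_eq_iff) auto
    have 2: "a' + Suc n * b' = a + Suc n * b \<longleftrightarrow> a' = a \<and> b' = b"
      using n n' by (intro radix_eq_iff) auto
    \<comment> \<open>Truncated subtraction would identify the exponents 0 and 1; for exponent 0 the
      coefficient vanishes, which \<open>t1\<close> takes into account.\<close>
    have 3: "a' - 1 = a \<and> b' - 1 = b \<longleftrightarrow> e = (a + 1, b + 1, c)" if "a' \<noteq> 0" "b' \<noteq> 0"
      using that n n' by auto
    have 4: "a' = a \<and> b' = b \<longleftrightarrow> e = (a, b, c + 2)"
      using n n' by auto
    have t1: "(if a' - 1 = a \<and> b' - 1 = b then C e * (4 * of_nat a' * of_nat b') else 0) =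
        (if e = (a + 1, b + 1, c) then of_nat (4 * (a + 1) * (b + 1)) * C e else 0)"
    proof (cases "a' = 0 \<or> b' = 0")
      case False
      have "C e * (4 * of_nat a' * of_nat b') = of_nat (4 * (a + 1) * (b + 1)) * C e"
        if "e = (a + 1, b + 1, c)"
      proof -
        have "a + 1 = a'" "b + 1 = b'"
          using that by simp_all
        then show ?thesis
          by (simp only: of_nat_mult of_nat_numeral mult.commute)
      qed
      then show ?thesis
        using 3 False by (metis (full_types))
    qed auto
    have t2: "(if a' = a \<and> b' = b then C e * (of_nat c' * of_nat (c' - 1)) else 0) =
        (if e = (a, b, c + 2) then of_nat ((c + 2) * (c + 1)) * C e else 0)"
    proof -
      have "C e * (of_nat c' * of_nat (c' - 1)) = of_nat ((c + 2) * (c + 1)) * C e"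
        if "e = (a, b, c + 2)"
      proof -
        have "c + 2 = c'" "c + 1 = c' - 1"
          using that by simp_all
        then show ?thesis
          by (simp only: of_nat_mult mult.commute)
      qed
      then show ?thesis
        using 4 by (metis (full_types))
    qed
    show "coeff (case e of (a, b, c) \<Rightarrow>
        Polynomial.monom (C e * (4 * of_nat a * of_nat b)) (a - 1 + Suc n * (b - 1)) +
        Polynomial.monom (C e * (of_nat c * of_nat (c - 1))) (a + Suc n * b)) (a + Suc n * b) =
      (if e = (a + 1, b + 1, c) then of_nat (4 * (a + 1) * (b + 1)) * C e else 0) +
      (if e = (a, b, c + 2) then of_nat ((c + 2) * (c + 1)) * C e else 0)"
      using t1 t2 by (simp only: \<open>e = (a', b', c')\<close> prod.case coeff_add coeff_monom 1 2)
  qed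
  also have "\<dots> = of_nat (4 * (a + 1) * (b + 1)) * C (a + 1, b + 1, c) +
      of_nat ((c + 2) * (c + 1)) * C (a, b, c + 2)"
  proof -
    have "(a + 1, b + 1, c) \<in> exponents n" "(a, b, c + 2) \<in> exponents n"
      using n by (auto simp: exponents_def)
    then show ?thesis
      unfolding sum.distrib sum.delta[OF finite_exponents] by (simp only: if_True)
  qed
  finally show ?thesis
    by (simp only: add_eq_0_iff eq_commute[of 0] minus_mult_left)
qed

section \<open>Parametrization of the null cone by pairs\<close>

definition null_vec :: "complex \<Rightarrow> complex \<Rightarrow> complex ^ 3"
  where "null_vec s t = of_uvw (s ^ 2) (- (t ^ 2)) (s * t)"

lemma bilin_null_vec: "bilin (null_vec s t) (null_vec s' t') = - ((s * t' - t * s') ^ 2) / 2"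
  by (simp add: bilin_uvw null_vec_def field_simps power2_eq_square)

lemma null_vec_in_null_cone: "null_vec s t \<in> null_cone"
  by (simp add: null_cone_def bilin_null_vec)

lemma null_vec_smult: "null_vec (c * s) (c * t) = c ^ 2 *s null_vec s t"
proof -
  have "of_uvw (k * u) (k * v) (k * w) = k *s of_uvw u v w" for k u v w
    by (simp add: Finite_Cartesian_Product.vec_eq_iff forall_3 field_simps)
  from this[of "c ^ 2" "s ^ 2" "- (t ^ 2)" "s * t"] show ?thesis
    unfolding null_vec_def by (simp add: power_mult_distrib power2_eq_square mult.left_commute mult.assoc)
qed

text \<open>For u nonzero, s is a square root of u and t = w / s; then v = -t^2 follows from u v +
  w^2 = 0. If u = 0 then w = 0, so s = 0 and t^2 = -v work.\<close>

lemma null_cone_eq_null_vec: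
  assumes "z \<in> null_cone"
  obtains s t where "z = null_vec s t"
proof -
  have uvw: "cu z * cv z + cw z ^ 2 = 0"
    using assms by (simp add: null_cone_def bilin_uvw power2_eq_square)
  show ?thesis
  proof (cases "cu z = 0")
    case True
    then have "z = null_vec 0 (csqrt (- cv z))"
      using uvw of_uvw_uvw[of z] by (simp add: null_vec_def)
    then show ?thesis by (rule that)
  next
    case False
    define s where "s = csqrt (cu z)"
    have s: "s ^ 2 = cu z" "s \<noteq> 0"
      using False by (auto simp: s_def)
    have "cv z = - (cw z ^ 2 / cu z)"
      using uvw False by (simp add: field_simps add_eq_0_iff)
    then have "z = null_vec s (cw z / s)"
      using s of_uvw_uvw[of z] by (simp add: null_vec_def power_divide)
    then show ?thesis by (rule that)
  qed
qed

text \<open>Along each weight space of the rotations fixing the third axis, the recurrence makes all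
  \<open>(-1)\<^sup>b C\<^sub>a\<^sub>b\<^sub>c\<close> positive multiples of one of them, and a coefficient of the restriction to the
  null cone is their sum.\<close>

lemma harmonic_form_eq_0:
  assumes f: "harmonic_form n f" and null: "\<And>z. z \<in> null_cone \<Longrightarrow> f z = 0"
  shows "f z = 0"
proof -
  obtain C where C: "\<And>z. f z = (\<Sum>e\<in>exponents n. C e * uvw_monom e z)"
    using uvw_form_coeffs f by (auto simp: harmonic_form_def)
  \<comment> \<open>The weight of (a, b, c) is k = 2 a + c; for k up to 2 n, \<open>G k\<close> is
    the signed coefficient at the exponent of weight k whose c is 0 or 1.\<close>
  define G where "G k = (- 1) ^ (n - k div 2 - k mod 2) * C (k div 2, n - k div 2 - k mod 2, k mod 2)" for k
  \<comment> \<open>The recurrence passes from (a, b, c + 2) to (a + 1, b + 1, c), which has the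
    same weight; its minus sign is absorbed by (-1)^b, so the factor stays positive.\<close>
  have pos: "\<exists>r>0. (- 1) ^ b * C (a, b, c) = of_real r * G (2 * a + c)" if "a + b + c = n" for a b c
    using that
  proof (induction c arbitrary: a b rule: induct_nat_012)
    case 0
    then have "b = n - a" by simp
    then show ?case
      by (intro exI[of _ 1]) (simp add: G_def)
  next
    case 1
    then have "b = n - a - 1" by simp
    then show ?case
      by (intro exI[of _ 1]) (simp add: G_def)
  next
    case (ge2 c)
    define k where "k = real (4 * (a + 1) * (b + 1)) / real ((c + 2) * (c + 1))"
    have "0 < 4 * (a + 1) * (b + 1)" "0 < (c + 2) * (c + 1)"
      by simp_all
    then have "k > 0"
      unfolding k_def by (intro divide_pos_pos) (simp_all only: of_nat_0_less_iff)
    have "of_nat ((c + 2) * (c + 1)) * C (a, b, c + 2) =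
        - of_nat (4 * (a + 1) * (b + 1)) * C (a + 1, b + 1, c)"
      using ge2.prems by (intro harmonic_form_recurrence[OF f C]) simp
    moreover have "of_nat ((c + 2) * (c + 1)) \<noteq> (0 :: complex)"
      by (simp only: of_nat_eq_0_iff) simp
    moreover have "complex_of_real k = of_nat (4 * (a + 1) * (b + 1)) / of_nat ((c + 2) * (c + 1))"
      by (simp only: k_def of_real_divide of_real_of_nat_eq)
    moreover have "y = - r * x" if "m * y = - l * x" "m \<noteq> 0" "r = l / m" for l m r x y :: complex
    proof -
      have "m * y = m * (- r * x)"
        using that by simp
      then show ?thesis
        using that(2) by (simp only: mult_cancel_left) simp
    qed
    ultimately have "C (a, b, c + 2) = - of_real k * C (a + 1, b + 1, c)"
      by metis
    then have *: "(- 1) ^ b * C (a, b, c + 2) = of_real k * ((- 1) ^ (b + 1) * C (a + 1, b + 1, c))"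
      by simp
    obtain r where "r > 0" "(- 1) ^ (b + 1) * C (a + 1, b + 1, c) = of_real r * G (2 * (a + 1) + c)"
      using ge2.IH(1)[of "a + 1" "b + 1"] ge2.prems by auto
    then show ?case
      using * \<open>k > 0\<close> by (intro exI[of _ "k * r"]) simp
  qed
  \<comment> \<open>The restriction of \<open>f\<close> to \<open>null_vec s 1\<close>, that is u =
    s^2, v = -1, w = s; the exponent of s is the weight.\<close>
  define P where "P = (\<Sum>e\<in>exponents n. case e of (a, b, c) \<Rightarrow>
      Polynomial.monom ((- 1) ^ b * C e) (2 * a + c))"
  have "poly P s = 0" for s
  proof -
    have "poly P s = (\<Sum>e\<in>exponents n. C e * uvw_monom e (null_vec s 1))"
      unfolding P_def poly_sum
    proof (rule sum.cong[OF refl])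
      fix e
      show "poly (case e of (a, b, c) \<Rightarrow> Polynomial.monom ((- 1) ^ b * C e) (2 * a + c)) s =
          C e * uvw_monom e (null_vec s 1)"
        by (cases e) (simp add: poly_monom null_vec_def power_add power_mult)
    qed
    also have "\<dots> = 0"
      using null[OF null_vec_in_null_cone] by (simp only: C)
    finally show ?thesis .
  qed
  then have "P = 0"
    using poly_all_0_iff_0 by blast
  have "\<forall>e. \<exists>r. e \<in> exponents n \<longrightarrow> r > 0 \<and>
      (- 1) ^ fst (snd e) * C e = of_real r * G (2 * fst e + snd (snd e))"
    using pos by (force simp: exponents_def)
  then obtain R where R: "\<And>e. e \<in> exponents n \<Longrightarrow> R e > 0 \<and>
      (- 1) ^ fst (snd e) * C e = of_real (R e) * G (2 * fst e + snd (snd e))"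
    by metis
  have "C e = 0" if e: "e \<in> exponents n" for e
  proof -
    define k where "k = 2 * fst e + snd (snd e)"
    \<comment> \<open>A sum of nonnegative terms, positive because \<open>e\<close> itself has
      weight \<open>k\<close>.\<close>
    define T where "T = (\<Sum>e\<in>exponents n. if 2 * fst e + snd (snd e) = k then R e else 0)"
    have "0 = coeff P k"
      using \<open>P = 0\<close> by simp
    also have "\<dots> = (\<Sum>e\<in>exponents n. of_real (if 2 * fst e + snd (snd e) = k then R e else 0) * G k)"
      unfolding P_def coeff_sum
    proof (rule sum.cong[OF refl])
      fix e assume "e \<in> exponents n"
      then show "coeff (case e of (a, b, c) \<Rightarrow> Polynomial.monom ((- 1) ^ b * C e) (2 * a + c)) k =
          of_real (if 2 * fst e + snd (snd e) = k then R e else 0) * G k"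
        using R[of e] by (cases e) auto
    qed
    also have "\<dots> = of_real T * G k"
      by (simp only: T_def of_real_sum sum_distrib_right)
    finally have "of_real T * G k = 0" ..
    moreover have "T > 0"
      unfolding T_def
      by (rule sum_pos2[OF finite_exponents e]) (use R e in \<open>auto simp: k_def less_imp_le\<close>)
    ultimately have "G k = 0"
      by simp
    then have "(- 1) ^ fst (snd e) * C e = 0"
      using R[OF e] by (simp add: k_def)
    then show ?thesis
      by simp
  qed
  then show ?thesis
    by (simp add: C)
qed

subsection \<open>Forms on the null cone as binary forms\<close>

text \<open>\<open>null_vec\<close> is quadratic in its arguments, so along an affine line in the
  parameter plane the degree at most doubles.\<close>

lemma uvw_form_null_line:
  assumes "uvw_form n f"
  shows "\<exists>q. degree q \<le> 2 * n \<and> (\<forall>r. f (null_vec (s + r * s') (t + r * t')) = poly q r)"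
  using assms
proof induction
  case (monom a b c n k)
  define q where "q = Polynomial.smult (k * (- 1) ^ b) ([:s, s':] ^ (2 * a + c) * [:t, t':] ^ (2 * b + c))"
  have le: "degree ([:x, y:] ^ e) \<le> e" for x y :: complex and e
    by (rule order_trans[OF degree_power_le]) simp
  have "degree q \<le> degree ([:s, s':] ^ (2 * a + c) * [:t, t':] ^ (2 * b + c))"
    unfolding q_def by (rule degree_smult_le)
  also have "\<dots> \<le> (2 * a + c) + (2 * b + c)"
    by (rule order_trans[OF degree_mult_le]) (intro add_mono le)
  finally have "degree q \<le> 2 * n"
    using monom by simp
  moreover have "k * (x ^ 2) ^ a * (- (y ^ 2)) ^ b * (x * y) ^ c =
      k * (- 1) ^ b * (x ^ (2 * a + c) * y ^ (2 * b + c))" for x y :: complex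
    by (simp add: power_minus[of "y ^ 2"] power_mult power_add power_mult_distrib)
  ultimately show ?case
    by (intro exI[of _ q]) (simp add: q_def null_vec_def poly_power mult.assoc[symmetric])
next
  case (add n f g)
  then obtain q q' where "degree q \<le> 2 * n" "degree q' \<le> 2 * n"
    "\<forall>r. f (null_vec (s + r * s') (t + r * t')) = poly q r"
    "\<forall>r. g (null_vec (s + r * s') (t + r * t')) = poly q' r"
    by blast
  then show ?case
    by (intro exI[of _ "q + q'"]) (simp add: degree_add_le)
qed

text \<open>The direction (1, r) works once \<open>r\<close> differs from every slope t'/s'. A pair
  with s' = 0 gives the value t', which is nonzero; its default slope 0 merely excludes r =
  0.\<close>

lemma avoid_finitely_many_directions:
  fixes B :: "(complex \<times> complex) set"
  assumes "finite B" "(0, 0) \<notin> B"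
  obtains s t where "\<And>s' t'. (s', t') \<in> B \<Longrightarrow> s * t' - t * s' \<noteq> 0"
proof -
  have "finite ((\<lambda>(s, t). t / s) ` B)"
    using assms by simp
  then obtain r where r: "r \<notin> (\<lambda>(s, t). t / s) ` B"
    using ex_new_if_finite infinite_UNIV_char_0 by blast
  have "1 * t' - r * s' \<noteq> 0" if B: "(s', t') \<in> B" for s' t'
  proof
    assume eq: "1 * t' - r * s' = 0"
    show False
    proof (cases "s' = 0")
      case True
      then show False
        using eq B assms(2) by simp
    next
      case False
      then have "r = t' / s'"
        using eq by (simp add: field_simps)
      then show False
        using r B by force
    qed
  qed
  then show ?thesis
    by (rule that)
qed

lemma proportional_pairs:
  fixes s t :: complex
  assumes "s * t' - t * s' = 0" "(s', t') \<noteq> (0, 0)"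
  obtains c where "s = c * s'" "t = c * t'"
proof (cases "s' = 0")
  case True
  then show ?thesis
    using assms that[of "t / t'"] by simp
next
  case False
  then have "t = s / s' * t'"
    using assms(1) by (simp add: field_simps)
  then show ?thesis
    using False that[of "s / s'"] by simp
qed

text \<open>In the parameter plane, a line through the parameters of \<open>z\<close> in a generic
  direction meets the span of each (S j, T j), at distinct r. So a polynomial of degree at most 2 n
  has more than 2 n roots, and its value at 0 is \<open>f z\<close>.\<close>

lemma uvw_form_null_eq_0:
  assumes f: "uvw_form n f" and J: "finite J" "card J > 2 * n"
    and zero: "\<And>j. j \<in> J \<Longrightarrow> f (null_vec (S j) (T j)) = 0"
    and nz: "\<And>j. j \<in> J \<Longrightarrow> (S j, T j) \<noteq> (0, 0)"
    and distinct: "\<And>i j. i \<in> J \<Longrightarrow> j \<in> J \<Longrightarrow> i \<noteq> j \<Longrightarrow> S i * T j - T i * S j \<noteq> 0"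
    and z: "z \<in> null_cone"
  shows "f z = 0"
proof -
  have hom: "f (null_vec (c * s) (c * t)) = (c ^ 2) ^ n * f (null_vec s t)" for c s t
    by (simp add: null_vec_smult uvw_form_homogeneous[OF f])
  obtain s t where st: "z = null_vec s t"
    using z by (rule null_cone_eq_null_vec)
  have "J \<noteq> {}"
    using J by auto
  show ?thesis
  proof (cases "(s, t) = (0, 0)")
    \<comment> \<open>At the origin, homogeneity with factor 0 reduces the claim to one of the given
      zeros; this includes n = 0, where \<open>f\<close> is constant.\<close>
    case True
    obtain j where "j \<in> J"
      using \<open>J \<noteq> {}\<close> by blast
    then show ?thesis
      using hom[of 0 "S j" "T j"] zero True st by simp
  next
    case False
    have "finite (insert (s, t) ((\<lambda>j. (S j, T j)) ` J))" "(0, 0) \<notin> insert (s, t) ((\<lambda>j. (S j, T j)) ` J)"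
      using J False nz by force+
    then obtain s' t' where s't': "\<And>x y. (x, y) \<in> insert (s, t) ((\<lambda>j. (S j, T j)) ` J) \<Longrightarrow> s' * y - t' * x \<noteq> 0"
      by (rule avoid_finitely_many_directions) blast
    then have nz': "s' * t - t' * s \<noteq> 0" "\<And>j. j \<in> J \<Longrightarrow> s' * T j - t' * S j \<noteq> 0"
      by auto
    \<comment> \<open>The parameter at which (s, t) + r (s', t') is proportional to (S j, T
      j).\<close>
    define r where "r j = - (s * T j - t * S j) / (s' * T j - t' * S j)" for j
    have r: "(s + r j * s') * T j - (t + r j * t') * S j = 0" if "j \<in> J" for j
    proof -
      have "r j * (s' * T j - t' * S j) = - (s * T j - t * S j)"
        using nz'(2)[OF that] by (simp add: r_def)
      then show ?thesis
        by (simp add: algebra_simps)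
    qed
    have inj: "inj_on r J"
    proof (rule inj_onI, rule ccontr)
      fix i j assume ij: "i \<in> J" "j \<in> J" "r i = r j" "i \<noteq> j"
      define x y where "x = s + r j * s'" and "y = t + r j * t'"
      have xy: "x * T i - y * S i = 0" "x * T j - y * S j = 0"
        using r[of i] r[of j] ij by (simp_all add: x_def y_def)
      \<comment> \<open>Cramer's rule: (x, y) is proportional to two independent vectors, hence
        zero, and then (s, t) would be a multiple of (s', t').\<close>
      have "(S i * T j - T i * S j) * x = S i * (x * T j - y * S j) - S j * (x * T i - y * S i)"
        "(S i * T j - T i * S j) * y = T i * (x * T j - y * S j) - T j * (x * T i - y * S i)"
        by (simp_all add: algebra_simps)
      then have "x = 0" "y = 0"
        using xy distinct[OF ij(1,2,4)] by simp_all
      then have "s = - r j * s'" "t = - r j * t'"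
        by (simp_all add: x_def y_def add_eq_0_iff)
      then have "s' * t - t' * s = 0"
        by simp
      then show False
        using nz'(1) by simp
    qed
    obtain q where q: "degree q \<le> 2 * n" "\<And>r. f (null_vec (s + r * s') (t + r * t')) = poly q r"
      using uvw_form_null_line[OF f] by blast
    have roots: "poly q (r j) = 0" if j: "j \<in> J" for j
    proof -
      obtain c where "s + r j * s' = c * S j" "t + r j * t' = c * T j"
        by (rule proportional_pairs[OF r[OF j] nz[OF j]])
      then show ?thesis
        using q(2)[of "r j"] hom[of c] zero[OF j] by simp
    qed
    have "q = 0"
    proof (rule ccontr)
      assume "q \<noteq> 0"
      then have "card (r ` J) \<le> card {x. poly q x = 0}"
        using roots by (intro card_mono poly_roots_finite) auto
      also have "\<dots> \<le> degree q"
        using \<open>q \<noteq> 0\<close> by (rule card_poly_roots_bound)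
      finally show False
        using q(1) J by (simp add: card_image[OF inj])
    qed
    then show ?thesis
      using q(2)[of 0] st by simp
  qed
qed

text \<open>Differentiating in the direction of one of the points removes its term and lowers the
  exponent.\<close>

lemma symplectic_powers_independent:
  fixes v :: "'i \<Rightarrow> complex"
  assumes "finite J" "card J \<le> m + 1"
    and "\<And>j. j \<in> J \<Longrightarrow> (S j, T j) \<noteq> (0, 0)"
    and "\<And>i j. i \<in> J \<Longrightarrow> j \<in> J \<Longrightarrow> i \<noteq> j \<Longrightarrow> S i * T j - T i * S j \<noteq> 0"
    and "\<And>s t. (\<Sum>j\<in>J. v j * (s * T j - t * S j) ^ m) = 0"
    and "j \<in> J"
  shows "v j = 0"
  using assms
proof (induction J arbitrary: m v j rule: finite_induct)
  case (insert l J)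
  have J0: "v j = 0" if j: "j \<in> J" for j
  proof -
    obtain k where k: "m = Suc k"
      using insert.hyps insert.prems(1) j by (cases m) auto
    have "v j * (S l * T j - T l * S j) = 0"
    proof (rule insert.IH[OF _ _ _ _ j])
      show "card J \<le> k + 1"
        using insert.hyps insert.prems(1) k by simp
      show "(S i, T i) \<noteq> (0, 0)" if "i \<in> J" for i
        using insert.prems(2) that by blast
      show "S i * T j - T i * S j \<noteq> 0" if "i \<in> J" "j \<in> J" "i \<noteq> j" for i j
        using insert.prems(3) that by blast
      show "(\<Sum>j\<in>J. v j * (S l * T j - T l * S j) * (s * T j - t * S j) ^ k) = 0" for s t
      proof -
        \<comment> \<open>\<open>F\<close> below is the vanishing sum at (s, t) + r (S l, T l); its
          derivative at r = 0 carries the factors \<open>B j\<close>, and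
          \<open>B l = 0\<close>.\<close>
        define A B where "A j = s * T j - t * S j" and "B j = S l * T j - T l * S j" for j
        define F where "F r = (\<Sum>j\<in>insert l J. v j * (A j + r * B j) ^ m)" for r
        have "((\<lambda>r. v j * (A j + r * B j) ^ m) has_field_derivative v j * (of_nat m * B j * A j ^ k)) (at 0)" for j
          unfolding k by (rule derivative_eq_intros refl | simp)+
        then have "(F has_field_derivative (\<Sum>j\<in>insert l J. v j * (of_nat m * B j * A j ^ k))) (at 0)"
          unfolding F_def by (intro DERIV_sum)
        moreover have "F r = 0" for r
        proof -
          have "F r = (\<Sum>j\<in>insert l J. v j * ((s + r * S l) * T j - (t + r * T l) * S j) ^ m)"
            unfolding F_def A_def B_def by (intro sum.cong refl) (simp add: algebra_simps)
          then show ?thesis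
            using insert.prems(4) by simp
        qed
        then have "F = (\<lambda>r. 0)"
          by (intro ext)
        ultimately have "(\<Sum>j\<in>insert l J. v j * (of_nat m * B j * A j ^ k)) = 0"
          using DERIV_const DERIV_unique by metis
        then have "(\<Sum>j\<in>J. v j * (of_nat m * B j * A j ^ k)) = 0"
          using insert.hyps by (simp add: B_def)
        moreover have "(\<Sum>j\<in>J. v j * (of_nat m * B j * A j ^ k)) = of_nat m * (\<Sum>j\<in>J. v j * B j * A j ^ k)"
          by (simp only: sum_distrib_left mult.commute mult.left_commute)
        moreover have "of_nat m \<noteq> (0 :: complex)"
          using k by (simp del: of_nat_Suc)
        ultimately show ?thesis
          by (simp add: A_def B_def)
      qed
    qed
    then show ?thesis
      using insert.prems(3)[of l j] insert.hyps j by auto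
  qed
  \<comment> \<open>With the other terms gone, evaluation at a point not proportional to (S l, T l)
    isolates \<open>v l\<close>.\<close>
  have "v l = 0"
  proof -
    have "finite {(S l, T l)}" "(0, 0) \<notin> {(S l, T l)}"
      using insert.prems(2)[of l] by auto
    then obtain s t where "\<And>x y. (x, y) \<in> {(S l, T l)} \<Longrightarrow> s * y - t * x \<noteq> 0"
      by (rule avoid_finitely_many_directions) blast
    then have "s * T l - t * S l \<noteq> 0"
      by blast
    moreover have "v l * (s * T l - t * S l) ^ m = 0"
      using insert.prems(4)[of s t] insert.hyps J0 by simp
    ultimately show ?thesis
      by simp
  qed
  then show ?case
    using J0 insert.prems(5) by blast
qed simp

subsection \<open>Bordered determinants\<close>

lemma bordered_matrix_carrier: "bordered_matrix m K a x y \<in> carrier_mat (Suc m) (Suc m)"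
  by (simp add: bordered_matrix_def)

lemma det_bordered_matrix_transpose:
  "Determinant.det (bordered_matrix m K a x y) = Determinant.det (bordered_matrix m (\<lambda>s t. K t s) a y x)"
proof -
  have "transpose_mat (bordered_matrix m K a x y) = bordered_matrix m (\<lambda>s t. K t s) a y x"
    by (rule eq_matI) (auto simp: bordered_matrix_def)
  then show ?thesis
    using Determinant.det_transpose[OF bordered_matrix_carrier] by metis
qed

lemma det_bordered_matrix_repeated:
  assumes "i < m"
  shows "Determinant.det (bordered_matrix m K a (a i) y) = 0"
proof (rule Determinant.det_identical_rows[OF bordered_matrix_carrier])
  show "i \<noteq> m" "i < Suc m" "m < Suc m"
    using assms by auto
  show "Matrix.row (bordered_matrix m K a (a i) y) i = Matrix.row (bordered_matrix m K a (a i) y) m"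
    using assms by (intro eq_vecI) (auto simp: bordered_matrix_def)
qed

text \<open>Laplace expansion along the last row, the only one containing \<open>x\<close>: the
  cofactors are constants and the entries are harmonic forms in \<open>x\<close>.\<close>

lemma harmonic_form_det_bordered_matrix:
  assumes "\<And>j. j < m \<Longrightarrow> harmonic_form n (\<lambda>x. K x (a j))" "harmonic_form n (\<lambda>x. K x y)"
  shows "harmonic_form n (\<lambda>x. Determinant.det (bordered_matrix m K a x y))"
proof -
  \<comment> \<open>Here \<open>a 0\<close> is an arbitrary filler for \<open>x\<close>, since the
    last row is deleted.\<close>
  define c where "c j = cofactor (bordered_matrix m K a (a 0) y) m j" for j
  have c: "cofactor (bordered_matrix m K a x y) m j = c j" for x j
  proof -
    have "mat_delete (bordered_matrix m K a x y) m j = mat_delete (bordered_matrix m K a (a 0) y) m j"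
      by (rule eq_matI) (auto simp: mat_delete_def bordered_matrix_def)
    then show ?thesis
      by (simp add: c_def cofactor_def)
  qed
  have "Determinant.det (bordered_matrix m K a x y) =
      (\<Sum>j<Suc m. bordered_matrix m K a x y $$ (m, j) * c j)" for x
    by (simp only: c laplace_expansion_row[OF bordered_matrix_carrier lessI])
  also have "\<dots> x = (\<Sum>j<Suc m. c j * K x (if j < m then a j else y))" for x
    by (intro sum.cong) (auto simp: bordered_matrix_def)
  finally have "(\<lambda>x. Determinant.det (bordered_matrix m K a x y)) =
      (\<lambda>x. \<Sum>j<Suc m. c j * K x (if j < m then a j else y))"
    by (intro ext)
  moreover have "harmonic_form n (\<lambda>x. \<Sum>j<Suc m. c j * K x (if j < m then a j else y))"
    using assms by (intro harmonic_form_sum harmonic_form_cmult) auto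
  ultimately show ?thesis
    by simp
qed

section \<open>The bordered determinant as a multiple of p(x) p(y)\<close>

lemma null_vec_eq_0_iff: "null_vec s t = 0 \<longleftrightarrow> (s, t) = (0, 0)"
proof
  assume "null_vec s t = 0"
  then have "cu (null_vec s t) = cu 0" "cv (null_vec s t) = cv 0"
    by simp_all
  moreover have "cu 0 = 0" "cv 0 = 0"
    by (simp_all add: cu_def cv_def)
  ultimately show "(s, t) = (0, 0)"
    by (simp add: null_vec_def)
qed (simp add: null_vec_def of_uvw_def Finite_Cartesian_Product.vec_eq_iff)

lemma complex_line_smult:
  assumes "c \<noteq> 0"
  shows "complex_line (c *s z) = complex_line z"
proof -
  have "complex_line (c *s z) = (\<lambda>t. t *s z) ` range (\<lambda>t. t * c)"
    by (auto simp: complex_line_def image_image vector_smult_assoc)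
  moreover have "range (\<lambda>t. t * c) = UNIV"
    using assms by (intro surjI[of _ "\<lambda>t. t / c"]) simp
  ultimately show ?thesis
    by (simp add: complex_line_def)
qed

text \<open>Stated for an abstract \<open>K\<close> so as to cover both the power of
  \<open>bilin\<close> and the zonal kernel. Harmonicity is asked for in the first variable and for
  null \<open>w\<close> only, as powers of \<open>bilin\<close> provide it.\<close>

lemma det_bordered_matrix_eq_product:
  fixes p :: "complex ^ 3 \<Rightarrow> complex" and a :: "nat \<Rightarrow> complex ^ 3"
  assumes p: "harmonic_form n p"
    and a: "\<And>i. i < 2 * n \<Longrightarrow> a i \<in> null_cone - {0}"
    and inj: "inj_on (\<lambda>i. complex_line (a i)) {..<2 * n}"
    and zeros: "p -` {0} \<inter> null_cone = (\<Union>i<2 * n. complex_line (a i))"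
    and K: "\<And>w. w \<in> null_cone \<Longrightarrow> harmonic_form n (\<lambda>z. K z w)"
    and K_null: "\<And>z w. z \<in> null_cone \<Longrightarrow> w \<in> null_cone \<Longrightarrow> K z w = k * bilin z w ^ n"
    and k: "k \<noteq> 0"
  shows "\<exists>c. c \<noteq> 0 \<and> (\<forall>x. \<forall>y\<in>null_cone.
    p x * p y = c * Determinant.det (bordered_matrix (2 * n) K a x y))"
proof -
  have "\<exists>s t. i < 2 * n \<longrightarrow> a i = null_vec s t" for i
    using a[of i] null_cone_eq_null_vec[of "a i"] by blast
  then obtain S T where ST: "\<And>i. i < 2 * n \<Longrightarrow> a i = null_vec (S i) (T i)"
    by metis
  have nz: "(S i, T i) \<noteq> (0, 0)" if "i < 2 * n" for i
    using a[OF that] ST[OF that] null_vec_eq_0_iff by auto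
  \<comment> \<open>Parameters of an auxiliary null vector \<open>y0\<close>, independent of those
    of every \<open>a i\<close>; the extra pair (1, 0) forces t0 to be nonzero, also when n =
    0.\<close>
  obtain s0 t0 where "\<And>x y. (x, y) \<in> insert (1, 0) ((\<lambda>i. (S i, T i)) ` {..<2 * n}) \<Longrightarrow>
      s0 * y - t0 * x \<noteq> 0"
  proof (rule avoid_finitely_many_directions)
    show "(0, 0) \<notin> insert (1, 0) ((\<lambda>i. (S i, T i)) ` {..<2 * n})"
      using nz by force
  qed auto
  then have t0: "t0 \<noteq> 0" and avoid: "\<And>i. i < 2 * n \<Longrightarrow> s0 * T i - t0 * S i \<noteq> 0"
    by (fastforce, auto)
  define y0 where "y0 = null_vec s0 t0"
  have y0: "y0 \<in> null_cone"
    by (simp add: y0_def null_vec_in_null_cone)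
  \<comment> \<open>Otherwise \<open>y0\<close> would lie on one of the lines and be orthogonal to
    some \<open>a i\<close>.\<close>
  have py0: "p y0 \<noteq> 0"
  proof
    assume "p y0 = 0"
    then have "y0 \<in> (\<Union>i<2 * n. complex_line (a i))"
      using y0 by (simp flip: zeros)
    then obtain i r where i: "i < 2 * n" "y0 = r *s a i"
      by (auto simp: complex_line_def)
    then have "bilin y0 (a i) = 0"
      using a[of i] by (simp add: bilin_smult null_cone_def)
    then show False
      using avoid i by (simp add: y0_def ST bilin_null_vec)
  qed
  have pa: "p (a i) = 0" if "i < 2 * n" for i
  proof -
    have "a i \<in> complex_line (a i)"
      unfolding complex_line_def by (rule range_eqI[of _ _ 1]) simp
    then have "a i \<in> p -` {0} \<inter> null_cone"
      unfolding zeros using that by blast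
    then show ?thesis
      by simp
  qed

  \<comment> \<open>\<open>y0\<close> joins the list at index 2 n, which gives the 2 n + 1 points
    that determine a form of degree n on the null cone.\<close>
  define S' T' b where "S' j = (if j < 2 * n then S j else s0)" and
    "T' j = (if j < 2 * n then T j else t0)" and "b j = (if j < 2 * n then a j else y0)" for j
  have b: "b j = null_vec (S' j) (T' j)" for j
    by (simp add: b_def S'_def T'_def ST y0_def)
  have b_null: "b j \<in> null_cone" for j
    by (simp add: b null_vec_in_null_cone)
  have nz': "(S' j, T' j) \<noteq> (0, 0)" for j
    using nz[of j] t0 by (simp add: S'_def T'_def)
  have distinct_a: "S i * T j - T i * S j \<noteq> 0" if ij: "i < 2 * n" "j < 2 * n" "i \<noteq> j" for i j
  proof
    assume "S i * T j - T i * S j = 0"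
    then obtain c where c: "S i = c * S j" "T i = c * T j"
      using nz[OF ij(2)] by (rule proportional_pairs)
    then have "a i = c ^ 2 *s a j"
      using ij by (simp add: ST null_vec_smult)
    moreover have "c \<noteq> 0"
      using c nz[OF ij(1)] by auto
    ultimately have "complex_line (a i) = complex_line (a j)"
      by (simp add: complex_line_smult)
    then show False
      using inj ij by (auto dest: inj_onD)
  qed
  have distinct: "S' i * T' j - T' i * S' j \<noteq> 0" if "i \<in> {..2 * n}" "j \<in> {..2 * n}" "i \<noteq> j" for i j
  proof -
    consider "i < 2 * n" "j < 2 * n" | "i = 2 * n" "j < 2 * n" | "i < 2 * n" "j = 2 * n"
      using \<open>i \<in> _\<close> \<open>j \<in> _\<close> \<open>i \<noteq> j\<close> by fastforce
    then show ?thesis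
    proof cases
      case 1
      then show ?thesis
        using distinct_a \<open>i \<noteq> j\<close> by (simp add: S'_def T'_def)
    next
      case 2
      then show ?thesis
        using avoid by (simp add: S'_def T'_def)
    next
      case 3
      then show ?thesis
        using avoid[of i] by (simp add: S'_def T'_def mult.commute)
    qed
  qed
  have null_eq_0: "g z = 0" if "uvw_form n g" "\<And>j. j \<le> 2 * n \<Longrightarrow> g (b j) = 0" "z \<in> null_cone" for g z
    by (rule uvw_form_null_eq_0[OF that(1), of "{..2 * n}" S' T'])
      (use that nz' distinct in \<open>auto simp flip: b\<close>)

  define D where "D x y = Determinant.det (bordered_matrix (2 * n) K a x y)" for x y
  have D: "D x y = D y0 y / p y0 * p x" if y: "y \<in> null_cone" for x y
  proof -
    \<comment> \<open>The factor is chosen so that \<open>g\<close> vanishes at \<open>y0\<close>;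
      at each \<open>a i\<close> both terms vanish, the first by a repeated row.\<close>
    define g where "g x = D x y + (- (D y0 y / p y0)) * p x" for x
    have "harmonic_form n (\<lambda>x. D x y)"
      unfolding D_def using a y K by (intro harmonic_form_det_bordered_matrix) auto
    then have g: "harmonic_form n g"
      unfolding g_def using p by (intro harmonic_form_add harmonic_form_cmult)
    have gb: "g (b j) = 0" if "j \<le> 2 * n" for j
      using py0 by (simp add: g_def b_def pa D_def det_bordered_matrix_repeated)
    have "g x = 0"
    proof (rule harmonic_form_eq_0[OF g])
      show "g z = 0" if "z \<in> null_cone" for z
        by (rule null_eq_0[of g]) (use g gb that in \<open>auto simp: harmonic_form_def\<close>)
    qed
    then show ?thesis
      by (simp add: g_def)
  qed
  have D_sym: "D x y = D y x" if "x \<in> null_cone" "y \<in> null_cone" for x y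
  proof -
    have "bordered_matrix (2 * n) (\<lambda>s t. K t s) a y x = bordered_matrix (2 * n) K a y x"
      using that a by (intro eq_matI) (auto simp: bordered_matrix_def K_null bilin_commute)
    then show ?thesis
      by (simp add: D_def det_bordered_matrix_transpose[of _ _ _ x])
  qed
  \<comment> \<open>A kernel vector \<open>v\<close> of this Gram matrix yields a combination of
    powers of \<open>bilin\<close> that vanishes at all 2 n + 1 points, hence on the null cone;
    independence of the powers then forces \<open>v = 0\<close>.\<close>
  have D_y0: "D y0 y0 \<noteq> 0"
  proof
    assume "D y0 y0 = 0"
    then obtain v where v: "v \<in> carrier_vec (Suc (2 * n))" "v \<noteq> 0\<^sub>v (Suc (2 * n))"
      "bordered_matrix (2 * n) K a y0 y0 *\<^sub>v v = 0\<^sub>v (Suc (2 * n))"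
      unfolding D_def det_0_iff_vec_prod_zero[OF bordered_matrix_carrier] by blast
    define g where "g z = (\<Sum>j\<le>2 * n. vec_index v j * bilin z (b j) ^ n)" for z
    have g: "uvw_form n g"
      unfolding g_def by (intro uvw_form_sum uvw_form_cmult uvw_form_bilin_power) simp
    have "g (b i) = 0" if i: "i \<le> 2 * n" for i
    proof -
      have "0 = vec_index (bordered_matrix (2 * n) K a y0 y0 *\<^sub>v v) i"
        using v(3) i by simp
      also have "\<dots> = (\<Sum>j<Suc (2 * n). K (b i) (b j) * vec_index v j)"
        using v(1) i by (auto simp: bordered_matrix_def scalar_prod_def b_def lessThan_atLeast0 intro!: sum.cong)
      also have "\<dots> = (\<Sum>j\<le>2 * n. k * (vec_index v j * bilin (b i) (b j) ^ n))"
        unfolding lessThan_Suc_atMost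
        by (intro sum.cong refl) (simp add: K_null b_null)
      also have "\<dots> = k * g (b i)"
        by (simp add: g_def sum_distrib_left)
      finally show ?thesis
        using k by simp
    qed
    then have g_null: "g z = 0" if "z \<in> null_cone" for z
      using null_eq_0[OF g] that by blast
    have "vec_index v j = 0" if "j \<le> 2 * n" for j
    proof (rule symplectic_powers_independent[of "{..2 * n}" "2 * n" S' T'])
      show "(\<Sum>j\<in>{..2 * n}. vec_index v j * (s * T' j - t * S' j) ^ (2 * n)) = 0" for s t
      proof -
        have "0 = g (null_vec s t)"
          using g_null[OF null_vec_in_null_cone] by simp
        also have "\<dots> = (\<Sum>j\<le>2 * n. (- 1 / 2) ^ n * (vec_index v j * (s * T' j - t * S' j) ^ (2 * n)))"
          unfolding g_def
        proof (intro sum.cong refl)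
          fix j
          have "bilin (null_vec s t) (b j) = (- 1 / 2) * (s * T' j - t * S' j) ^ 2"
            by (simp add: b bilin_null_vec)
          then show "vec_index v j * bilin (null_vec s t) (b j) ^ n =
              (- 1 / 2) ^ n * (vec_index v j * (s * T' j - t * S' j) ^ (2 * n))"
            by (simp only: power_mult_distrib power_mult mult.left_commute)
        qed
        finally show ?thesis
          by (simp flip: sum_distrib_left)
      qed
    qed (use that nz' distinct in auto)
    then have "v = 0\<^sub>v (Suc (2 * n))"
      using v(1) by (intro eq_vecI) auto
    then show False
      using v(2) by simp
  qed
  have "p x * p y = (p y0) ^ 2 / D y0 y0 * D x y" if y: "y \<in> null_cone" for x y
  proof -
    \<comment> \<open>\<open>D\<close> applies twice: to \<open>D x y\<close> in x, and, after
      exchanging arguments by symmetry, to \<open>D y0 y\<close> in y.\<close>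
    have "D x y = D y0 y0 / p y0 * p y / p y0 * p x"
      using D[OF y, of x] D_sym[OF y0 y] D[OF y0, of y] by simp
    then show ?thesis
      using D_y0 py0 by (simp add: power2_eq_square)
  qed
  then show ?thesis
    using D_y0 py0 unfolding D_def by (intro exI[of _ "(p y0) ^ 2 / D y0 y0"]) (simp add: D_def)
qed

subsection \<open>The zonal kernel on the null cone\<close>

text \<open>Multiplication by X^2 - 1 relates only coefficients with indices of the same
  parity.\<close>

lemma coeff_quadratic_power_odd:
  "odd j \<Longrightarrow> coeff ([:- 1, 0, 1:] ^ n :: real poly) j = 0"
proof (induction n arbitrary: j)
  case 0
  then show ?case
    by (cases j) auto
next
  case (Suc n)
  show ?case
  proof (cases j)
    case (Suc i)
    then have "odd j" "even i"
      using Suc.prems by auto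
    have "[:- 1, 0, 1:] * q = - q + pCons 0 (pCons 0 q)" for q :: "real poly"
      by simp
    then have "coeff ([:- 1, 0, 1:] ^ Suc n :: real poly) j =
        - coeff ([:- 1, 0, 1:] ^ n) j + coeff (pCons 0 ([:- 1, 0, 1:] ^ n)) i"
      by (simp add: Suc)
    also have "\<dots> = 0"
      using Suc.IH[OF \<open>odd j\<close>] Suc.IH[of "i - 1"] \<open>even i\<close> by (cases i) auto
    finally show ?thesis .
  qed (use Suc.prems in simp)
qed

text \<open>Coefficient j of the n-th derivative is a multiple of coefficient n + j of the even
  polynomial (X^2 - 1)^n.\<close>

lemma coeff_legendre_parity:
  assumes "odd (n + j)"
  shows "coeff (legendre n) j = 0"
  using assms by (simp add: legendre_def coeff_higher_pderiv coeff_quadratic_power_odd add.commute)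

lemma degree_quadratic_power: "degree ([:- 1, 0, 1:] ^ n :: real poly) = 2 * n"
  by (simp add: degree_power_eq)

lemma degree_legendre_le: "degree (legendre n) \<le> n"
  unfolding legendre_def
  by (rule order_trans[OF degree_smult_le]) (simp add: degree_higher_pderiv degree_quadratic_power)

text \<open>The n-th derivative multiplies the leading coefficient 1 of (X^2 - 1)^n by a nonzero
  rising factorial.\<close>

lemma coeff_legendre_top: "coeff (legendre n) n \<noteq> 0"
proof -
  have "coeff ([:- 1, 0, 1:] ^ n :: real poly) (2 * n) = lead_coeff [:- 1, 0, 1:] ^ n"
    using lead_coeff_power[of "[:- 1, 0, 1:] :: real poly" n] by (simp only: degree_quadratic_power)
  then show ?thesis
    by (simp add: legendre_def coeff_higher_pderiv pochhammer_eq_0_iff flip: mult_2)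
qed

section \<open>From real arguments to null vectors\<close>

lemma bilin_of_real_vec: "bilin (of_real_vec x) (of_real_vec y) = of_real (inner x y)"
  by (simp add: bilin_def of_real_vec_def inner_vec_def)

lemma of_real_vec_scaleR: "of_real_vec (r *\<^sub>R x) = of_real r *s of_real_vec x"
  by (simp add: of_real_vec_def Finite_Cartesian_Product.vec_eq_iff)

text \<open>A nonzero null vector has linearly independent real and imaginary parts, so the real line
  through them avoids the origin.\<close>

lemma poly_on_lines_null_eqI:
  assumes "poly_on_lines f" "poly_on_lines g"
    and eq: "\<And>x. x \<noteq> 0 \<Longrightarrow> f (of_real_vec x) = g (of_real_vec x)"
    and z: "z \<in> null_cone" "z \<noteq> 0"
  shows "f z = g z"
proof -
  obtain x y where xy: "z = of_real_vec x + \<i> *s of_real_vec y"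
    by (rule complex_vec_decomp)
  have "x + t *\<^sub>R y \<noteq> 0" for t
  proof
    assume "x + t *\<^sub>R y = 0"
    then have "x = (- t) *\<^sub>R y"
      by (simp add: add_eq_0_iff)
    then have z': "z = (\<i> - of_real t) *s of_real_vec y"
      unfolding xy by (simp add: of_real_vec_def Finite_Cartesian_Product.vec_eq_iff algebra_simps)
    have "bilin z z = (\<i> - of_real t) * ((\<i> - of_real t) * of_real (inner y y))"
      unfolding z' by (simp only: bilin_smult bilin_commute[of "of_real_vec y"] bilin_of_real_vec)
    moreover have "\<i> - of_real t \<noteq> 0"
      by (simp add: complex_eq_iff)
    ultimately have "inner y y = 0"
      using z(1) by (simp add: null_cone_def)
    then have "z = 0"
      unfolding z' by (simp add: of_real_vec_def Finite_Cartesian_Product.vec_eq_iff)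
    then show False
      using z(2) by simp
  qed
  then show ?thesis
    unfolding xy using eq by (intro poly_on_lines_eqI[OF assms(1,2)]) blast
qed

text \<open>Only z = 0 remains, where both forms are 0^n times their values at a nonzero null
  vector.\<close>

lemma uvw_form_null_eqI:
  assumes f: "uvw_form n f" and g: "uvw_form n g"
    and eq: "\<And>z. z \<in> null_cone \<Longrightarrow> z \<noteq> 0 \<Longrightarrow> f z = g z"
    and z: "z \<in> null_cone"
  shows "f z = g z"
proof (cases "z = 0")
  case True
  have z': "0 *s null_vec 1 0 = z" and "null_vec 1 0 \<noteq> 0"
    using True by (simp_all add: null_vec_eq_0_iff)
  then show ?thesis
    using uvw_form_homogeneous[OF f, of 0 "null_vec 1 0"] uvw_form_homogeneous[OF g, of 0 "null_vec 1 0"]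
      eq[OF null_vec_in_null_cone, of 1 0] unfolding z' by simp
qed (use eq z in blast)

lemma poly_on_lines_bilin: "poly_on_lines (\<lambda>z. bilin z w)"
  using poly_on_lines_uvw_form[OF uvw_form_bilin_power[of 1 w]] by simp

lemma poly_on_lines_bilin_self: "poly_on_lines (\<lambda>z. bilin z z)"
proof -
  have "bilin z z = cu z * cv z + cw z * cw z" for z
    by (simp add: bilin_uvw mult.commute)
  then show ?thesis
    by (simp only:) (intro poly_on_lines_intros)
qed

text \<open>On nonzero real vectors \<open>\<phi>\<close> is a homogenized Legendre polynomial. Each
  of its nonzero terms below the top one contains a power of \<open>bilin z z\<close>, so only the
  top one survives on null vectors, which replace real arguments one variable at a time.\<close>

lemma zonal_kernel_null_cone:
  assumes "is_zonal_kernel n \<phi>"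
  obtains k where "k \<noteq> 0"
    "\<And>z w. z \<in> null_cone \<Longrightarrow> w \<in> null_cone \<Longrightarrow> \<phi> z w = k * bilin z w ^ n"
proof -
  obtain c where c: "c > 0" "\<And>a x. a \<in> sphere 0 1 \<Longrightarrow> x \<in> sphere 0 1 \<Longrightarrow>
      \<phi> (of_real_vec a) (of_real_vec x) = of_real (c * poly (legendre n) (inner a x))"
    using assms unfolding is_zonal_kernel_def by blast
  have f1: "uvw_form n (\<lambda>z. \<phi> z w)" and f2: "uvw_form n (\<phi> z)" for z w
    using assms unfolding is_zonal_kernel_def harmonic_polys_def
    by (blast intro: uvw_form_homogeneous_polys)+
  define l where "l j = coeff (legendre n) j" for j
  \<comment> \<open>For odd n - j the rounding in \<open>div\<close> is harmless, because
    \<open>l j = 0\<close> by parity.\<close>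
  define Q where "Q z w = (\<Sum>j\<le>n. of_real (c * l j) *
      (bilin z w ^ j * (bilin z z * bilin w w) ^ ((n - j) div 2)))" for z w
  have real: "\<phi> (of_real_vec a) (of_real_vec x) = Q (of_real_vec a) (of_real_vec x)"
    if ax: "a \<noteq> 0" "x \<noteq> 0" for a x
  proof -
    define u where "u = inner (sgn a) (sgn x)"
    have polar: "a = norm a *\<^sub>R sgn a" "x = norm x *\<^sub>R sgn x"
      using ax by (simp_all add: sgn_div_norm)
    then have split: "of_real_vec a = of_real (norm a) *s of_real_vec (sgn a)"
      "of_real_vec x = of_real (norm x) *s of_real_vec (sgn x)"
      by (metis of_real_vec_scaleR)+
    have "inner (norm a *\<^sub>R sgn a) (norm x *\<^sub>R sgn x) = norm a * norm x * u"
      by (simp add: u_def)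
    then have ip: "inner a x = norm a * norm x * u"
      using polar by metis
    have sgn: "\<phi> (of_real_vec (sgn a)) (of_real_vec (sgn x)) = of_real (c * poly (legendre n) u)"
      unfolding u_def using ax by (intro c(2)) (simp_all add: norm_sgn)
    have "\<phi> (of_real_vec a) (of_real_vec x) =
        of_real (norm a) ^ n * (of_real (norm x) ^ n * \<phi> (of_real_vec (sgn a)) (of_real_vec (sgn x)))"
      unfolding split uvw_form_homogeneous[OF f1] uvw_form_homogeneous[OF f2] by (rule mult.left_commute)
    also have "\<dots> = of_real ((norm a * norm x) ^ n * (c * poly (legendre n) u))"
      by (simp add: sgn power_mult_distrib)
    also have "(norm a * norm x) ^ n * (c * poly (legendre n) u) =
        (\<Sum>j\<le>n. c * l j * (inner a x ^ j * (inner a a * inner x x) ^ ((n - j) div 2)))"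
    proof -
      have "poly (legendre n) u = (\<Sum>j\<le>n. l j * u ^ j)"
        unfolding poly_altdef l_def using degree_legendre_le[of n]
        by (intro sum.mono_neutral_left) (auto simp: coeff_eq_0)
      then have "(norm a * norm x) ^ n * (c * poly (legendre n) u) =
          (\<Sum>j\<le>n. (norm a * norm x) ^ n * (c * (l j * u ^ j)))"
        by (simp only: sum_distrib_left)
      also have "\<dots> = (\<Sum>j\<le>n. c * l j * (inner a x ^ j * (inner a a * inner x x) ^ ((n - j) div 2)))"
      proof (intro sum.cong refl)
        fix j assume "j \<in> {..n}"
        show "(norm a * norm x) ^ n * (c * (l j * u ^ j)) =
            c * l j * (inner a x ^ j * (inner a a * inner x x) ^ ((n - j) div 2))"
        proof (cases "odd (n + j)")
          case True
          then show ?thesis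
            by (simp add: l_def coeff_legendre_parity)
        next
          case False
          then have "n = j + 2 * ((n - j) div 2)"
            using \<open>j \<in> {..n}\<close> by auto
          then have "(norm a * norm x) ^ n = (norm a * norm x) ^ j * ((norm a * norm x) ^ 2) ^ ((n - j) div 2)"
            by (metis power_add power_mult)
          also have "(norm a * norm x) ^ 2 = inner a a * inner x x"
            by (simp add: power_mult_distrib power2_norm_eq_inner)
          finally show ?thesis
            by (simp add: ip power_mult_distrib)
        qed
      qed
      finally show ?thesis .
    qed
    also have "of_real \<dots> = Q (of_real_vec a) (of_real_vec x)"
      by (simp add: Q_def bilin_of_real_vec)
    finally show ?thesis .
  qed
  have Q_null: "Q z w = of_real (c * l n) * bilin z w ^ n" if z: "z \<in> null_cone" for z w
  proof -
    have "Q z w = (\<Sum>j\<le>n. if j = n then of_real (c * l n) * bilin z w ^ n else 0)"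
      unfolding Q_def
    proof (intro sum.cong refl)
      fix j assume "j \<in> {..n}"
      then have "j = n \<or> odd (n + j) \<and> j \<noteq> n \<or> j \<noteq> n \<and> (n - j) div 2 \<noteq> 0"
        unfolding atMost_iff by presburger
      then consider "j = n" | "odd (n + j)" "j \<noteq> n" | "j \<noteq> n" "(n - j) div 2 \<noteq> 0"
        by blast
      then show "of_real (c * l j) * (bilin z w ^ j * (bilin z z * bilin w w) ^ ((n - j) div 2)) =
          (if j = n then of_real (c * l n) * bilin z w ^ n else 0)"
        using z by cases (simp_all add: l_def coeff_legendre_parity null_cone_def)
    qed
    then show ?thesis
      by simp
  qed
  \<comment> \<open>The first argument becomes null while the second stays real;
    \<open>nonzero\<close> below treats the second one in the same way.\<close>
  have half: "\<phi> z (of_real_vec x) = of_real (c * l n) * bilin z (of_real_vec x) ^ n"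
    if "z \<in> null_cone" "z \<noteq> 0" "x \<noteq> 0" for z x
  proof -
    have "poly_on_lines (\<lambda>z. Q z w)" for w
      unfolding Q_def by (intro poly_on_lines_intros poly_on_lines_bilin poly_on_lines_bilin_self)
    then have "\<phi> z (of_real_vec x) = Q z (of_real_vec x)"
      by (rule poly_on_lines_null_eqI[OF poly_on_lines_uvw_form[OF f1]]) (use real that in auto)
    then show ?thesis
      using Q_null that by simp
  qed
  have g: "uvw_form n (\<lambda>w. of_real (c * l n) * bilin z w ^ n)" for z
    unfolding bilin_commute[of z] by (intro uvw_form_cmult uvw_form_bilin_power)
  have nonzero: "\<phi> z w = of_real (c * l n) * bilin z w ^ n"
    if "z \<in> null_cone" "z \<noteq> 0" "w \<in> null_cone" "w \<noteq> 0" for z w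
    by (rule poly_on_lines_null_eqI[OF poly_on_lines_uvw_form[OF f2] poly_on_lines_uvw_form[OF g]])
      (use half that in auto)
  have "\<phi> z w = of_real (c * l n) * bilin z w ^ n" if "z \<in> null_cone" "w \<in> null_cone" "w \<noteq> 0" for z w
    by (rule uvw_form_null_eqI[OF f1 uvw_form_cmult[OF uvw_form_bilin_power]])
      (use nonzero that in auto)
  then have "\<phi> z w = of_real (c * l n) * bilin z w ^ n" if "z \<in> null_cone" "w \<in> null_cone" for z w
    using that by (blast intro: uvw_form_null_eqI[OF f2 g])
  moreover have "complex_of_real (c * l n) \<noteq> 0"
    using c(1) coeff_legendre_top by (simp add: l_def)
  ultimately show ?thesis
    using that by blast
qed

section \<open>The two determinant representations\<close>

theorem theorem2:
  fixes n :: nat and p :: "complex ^ 3 \<Rightarrow> complex" and a :: "nat \<Rightarrow> complex ^ 3"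
  assumes "p \<in> harmonic_polys n"
    and "\<And>i. i < 2 * n \<Longrightarrow> a i \<in> null_cone - {0}"
    and "inj_on (\<lambda>i. complex_line (a i)) {..<2 * n}"
    and "p -` {0} \<inter> null_cone = (\<Union>i<2 * n. complex_line (a i))"
  shows "(\<exists>c. c \<noteq> 0 \<and> (\<forall>x. \<forall>y\<in>null_cone.
            p x * p y = c * Determinant.det (bordered_matrix (2 * n) (\<lambda>s t. bilin s t ^ n) a x y)))
       \<and> (\<forall>\<phi>. is_zonal_kernel n \<phi> \<longrightarrow>
            (\<exists>c. c \<noteq> 0 \<and> (\<forall>x y.
              p x * p y = c * Determinant.det (bordered_matrix (2 * n) \<phi> a x y))))"
proof (intro conjI allI impI)
  have p: "harmonic_form n p"
    using assms(1) by (rule harmonic_form_harmonic_polys)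
  note main = det_bordered_matrix_eq_product[OF p assms(2-4)]
  show "\<exists>c. c \<noteq> 0 \<and> (\<forall>x. \<forall>y\<in>null_cone.
      p x * p y = c * Determinant.det (bordered_matrix (2 * n) (\<lambda>s t. bilin s t ^ n) a x y))"
    by (rule main[where k = 1]) (simp_all add: harmonic_form_bilin_power)
  fix \<phi> assume \<phi>: "is_zonal_kernel n \<phi>"
  have h1: "harmonic_form n (\<lambda>z. \<phi> z w)" and h2: "harmonic_form n (\<lambda>w. \<phi> z w)" for z w
    using \<phi> unfolding is_zonal_kernel_def by (blast intro: harmonic_form_harmonic_polys)+
  obtain k where "k \<noteq> 0" "\<And>z w. z \<in> null_cone \<Longrightarrow> w \<in> null_cone \<Longrightarrow> \<phi> z w = k * bilin z w ^ n"
    using zonal_kernel_null_cone[OF \<phi>] by metis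
  then obtain c where c: "c \<noteq> 0" "\<And>x y. y \<in> null_cone \<Longrightarrow>
      p x * p y = c * Determinant.det (bordered_matrix (2 * n) \<phi> a x y)"
    using main[of \<phi> k] h1 by metis
  \<comment> \<open>For fixed \<open>x\<close> the difference of the two sides is a harmonic form in
    \<open>y\<close> that vanishes on the null cone, hence everywhere.\<close>
  have "p x * p y = c * Determinant.det (bordered_matrix (2 * n) \<phi> a x y)" for x y
  proof -
    have "harmonic_form n (\<lambda>y. Determinant.det (bordered_matrix (2 * n) \<phi> a x y))"
      unfolding det_bordered_matrix_transpose[of _ \<phi>]
      by (intro harmonic_form_det_bordered_matrix h2)
    then have "harmonic_form n (\<lambda>y. p x * p y + (- c) * Determinant.det (bordered_matrix (2 * n) \<phi> a x y))"
      by (intro harmonic_form_add harmonic_form_cmult p)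
    from harmonic_form_eq_0[OF this, of y] show ?thesis
      using c(2) by simp
  qed
  then show "\<exists>c. c \<noteq> 0 \<and> (\<forall>x y. p x * p y = c * Determinant.det (bordered_matrix (2 * n) \<phi> a x y))"
    using c(1) by blast
qed

end
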